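(* Let $\theta=\cot^{-1}\sqrt{15}$. For every integer $k\ge 1$, $$\begin{aligned}\zeta(4k+1)=\;&(2\pi)^{4k+1}\sum_{j=0}^k \frac{(-1)^{j}\, c_{jk}\, B_{2j}\, B_{4k+2-2j}}{(2j)!\,(4k+2-2j)!}+\cot(2k\theta)\,\mathcal{S}_{e^{-\sqrt{15}\pi}}(-4k-1)\\&+\left(2^{-4k}+2\right)\mathcal{L}_{e^{-\sqrt{15}\pi}}(-4k-1)\\&-\left(2^{-8k}+3\times2^{-4k}+4\right)\mathcal{L}_{e^{-2\sqrt{15}\pi}}(-4k-1)\\&+\left(2^{-8k}+2^{-4k+1}\right)\mathcal{L}_{e^{-4\sqrt{15}\pi}}(-4k-1),\end{aligned}$$ where $$c_{jk}=\csc(2k\theta)\,\sin[(2k+1-2j)\theta].$$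
   Context: For complex $q$ with $|q|<1$ and $s\in\mathbb{C}$, the Lambert series is $\mathcal{L}_q(s)=\sum_{n=1}^\infty \frac{n^s q^n}{1-q^n}$. For $0<q<1$ and $s\in\mathbb{C}$, $\mathcal{S}_q(s)= i\left[\mathcal{L}_{i\sqrt{q}}(s)-\mathcal{L}_{-i\sqrt{q}}(s)\right]$, where $i=\sqrt{-1}$ and $\sqrt{q}>0$. $\zeta$ is the Riemann zeta function and $B_m$ is the $m$th Bernoulli number. $\cot^{-1}\sqrt{15}$ denotes the angle in $(0,\pi/2)$ whose cotangent is $\sqrt{15}$. *)

theory Defs
  imports
    "HOL-Analysis.Analysis"
    "HOL-Computational_Algebra.Formal_Power_Series"
begin

text \<open>
  The Riemann zeta function, by its Dirichlet series. The series converges, and hence the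
  definition is meaningful, only in the half-plane \<open>Re s > 1\<close>; the analytic continuation
  is not needed here.
\<close>

definition riemann_zeta :: "complex \<Rightarrow> complex" where
  "riemann_zeta s = (\<Sum>n. 1 / of_nat (Suc n) powr s)"

text \<open>
  \<open>\<Sum>\<^sub>m B\<^sub>m t\<^sup>m / m! = t / (exp t - 1)\<close>, an identity of formal power
  series; in particular \<open>B\<^sub>1 = -1/2\<close>.
\<close>

definition bernoulli :: "nat \<Rightarrow> real" where
  "bernoulli m = fact m * fps_nth (fps_X / (fps_exp 1 - 1)) m"

text \<open>Meaningful for \<open>norm q < 1\<close>; the index \<open>n\<close> is shifted by one.\<close>

definition lambert :: "complex \<Rightarrow> complex \<Rightarrow> complex" where
  "lambert q s = (\<Sum>n. of_nat (Suc n) powr s * q ^ Suc n / (1 - q ^ Suc n))"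

text \<open>Meaningful for \<open>0 < q < 1\<close>.\<close>

definition lambert_S :: "real \<Rightarrow> complex \<Rightarrow> complex" where
  "lambert_S q s =
     \<i> * (lambert (\<i> * of_real (sqrt q)) s - lambert (- \<i> * of_real (sqrt q)) s)"

definition c_coeff :: "real \<Rightarrow> nat \<Rightarrow> nat \<Rightarrow> real" where
  "c_coeff \<theta> j k =
     1 / sin (2 * real k * \<theta>) * sin ((2 * real k + 1 - 2 * real j) * \<theta>)"

end

theory Submission
  imports Defs
begin

text \<open>
  For \<open>Im \<tau> > 0\<close> put \<open>u = (n\<tau>)\<^sup>2\<close> and \<open>v = m\<^sup>2\<close>. The finite geometric sum for
  \<open>1/(u\<^sup>K (u - v)) - 1/(v\<^sup>K (u - v))\<close>, summed over all \<open>m, n \<ge> 1\<close>, relates two absolutely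
  convergent double series to products of even zeta values, which are Bernoulli numbers. By the
  partial fractions of the cotangent, the two double series are Lambert series at
  \<open>exp (2\<pi>i\<tau>)\<close> and \<open>exp (-2\<pi>i/\<tau>)\<close>, so this is Ramanujan's reciprocity formula for
  \<open>\<zeta>(2K + 1)\<close>. At \<open>\<tau> = i exp (-i\<theta>) = (1 + i\<surd>15)/4\<close>, which lies on the unit circle, the
  two nomes are \<open>\<plusminus>i\<surd>q\<close> with \<open>q = exp (-\<pi>\<surd>15)\<close>. The difference of the two
  Lambert series is \<open>S\<close> up to a factor \<open>i\<close>, and their sum reduces to the Lambert series at
  \<open>q\<close>, \<open>q\<^sup>2\<close>, \<open>q\<^sup>4\<close> by sorting the summation index modulo 4.
\<close>

section \<open>Infinite sums and the cotangent\<close>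

lemma has_sum_from_1_iff:
  "(f has_sum S) {1::nat..} \<longleftrightarrow> ((\<lambda>n. f (Suc n)) has_sum S) UNIV"
proof -
  have "bij_betw Suc UNIV {1..}"
    by (rule bij_betwI[of _ _ _ "\<lambda>n. n - 1"]) auto
  from has_sum_reindex_bij_betw[OF this, of f S] show ?thesis by simp
qed

lemma summable_on_inverse_power_from_1:
  assumes "p \<ge> 2"
  shows "(\<lambda>n. 1 / real n ^ p) summable_on {1..}"
proof -
  have "summable (\<lambda>n. inverse (real n ^ p))"
    using inverse_power_summable[OF assms, where 'a=real] by simp
  then have "(\<lambda>n. inverse (real n ^ p)) summable_on UNIV"
    by (subst summable_on_UNIV_nonneg_real_iff) auto
  then show ?thesis
    by (metis (mono_tags, lifting) inverse_eq_divide summable_on_cong summable_on_subset_banach top_greatest)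
qed

text \<open>By the reflection formula, Gamma(w) Gamma(1 - w) sin(\<pi>w) is the constant \<pi> off
  the integers, so its derivative vanishes there. Dividing out the nonzero Gamma factors and the
  sine leaves the claim.\<close>

lemma cot_digamma:
  fixes z :: complex
  assumes z: "z \<notin> \<int>"
  shows "of_real pi * cot (of_real pi * z) = Digamma (1 - z) - Digamma z"
proof -
  let ?p = "of_real pi :: complex"
  have z1: "z \<notin> \<int>\<^sub>\<le>\<^sub>0" "1 - z \<notin> \<int>\<^sub>\<le>\<^sub>0"
    using z nonpos_Ints_Int Ints_1 Ints_diff[of 1 "1 - z"] by fastforce+
  have sinz: "sin (?p * z) \<noteq> 0"
    using z by (auto simp: sin_eq_0 mult.commute)
  let ?f = "\<lambda>w. Gamma w * Gamma (1 - w) * sin (?p * w)"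
  have "(?f has_field_derivative
      (Gamma z * Digamma z * Gamma (1 - z) - Gamma z * (Gamma (1 - z) * Digamma (1 - z))) * sin (?p * z)
      + Gamma z * Gamma (1 - z) * (cos (?p * z) * ?p)) (at z)"
    using z1 by (auto intro!: derivative_eq_intros simp: algebra_simps)
  moreover have "(?f has_field_derivative 0) (at z)"
  proof (rule has_field_derivative_transform_within_open)
    show "((\<lambda>_. ?p) has_field_derivative 0) (at z)" by simp
    show "open (- \<int> :: complex set)" unfolding Ints_def by (intro open_Compl closed_of_int_image)
    show "z \<in> - \<int>" using z by simp
    fix w :: complex assume "w \<in> - \<int>"
    then have "sin (?p * w) \<noteq> 0" by (auto simp: sin_eq_0 mult.commute)
    then show "?p = ?f w" by (simp add: Gamma_reflection_complex)
  qed
  ultimately have "(Gamma z * Digamma z * Gamma (1 - z) - Gamma z * (Gamma (1 - z) * Digamma (1 - z))) * sin (?p * z)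
      + Gamma z * Gamma (1 - z) * (cos (?p * z) * ?p) = 0"
    by (rule DERIV_unique)
  then have "(Gamma z * Gamma (1 - z)) * ((Digamma z - Digamma (1 - z)) * sin (?p * z) + ?p * cos (?p * z)) = 0"
    by (simp add: algebra_simps)
  then have "(Digamma z - Digamma (1 - z)) * sin (?p * z) + ?p * cos (?p * z) = 0"
    using z1 by (simp add: Gamma_eq_zero_iff)
  then show ?thesis using sinz by (simp add: cot_def field_simps)
qed

text \<open>The Digamma series at 1 - z and z + 1 are subtracted term by term; Euler's constant
  cancels, and shifting Digamma from z + 1 back to z produces the term 1/z. Since
  \<open>has_sum\<close> is unconditional, absolute convergence is then checked separately.\<close>

lemma cot_partial_fractions:
  fixes z :: complex
  assumes z: "z \<notin> \<int>"
  shows "((\<lambda>m. 2 * z / (z\<^sup>2 - of_nat m ^ 2)) has_sum (of_real pi * cot (of_real pi * z) - 1 / z)) {1..}"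
proof -
  have nz: "z \<noteq> 0" "1 - z \<noteq> 0" "z + 1 \<noteq> 0" using z by (auto simp: add_eq_0_iff2 minus_equation_iff[of z])
  have ne: "z + of_nat (Suc k) \<noteq> 0" "z - of_nat (Suc k) \<noteq> 0" for k
  proof -
    show "z + of_nat (Suc k) \<noteq> 0" using z
      by (metis Ints_minus Ints_of_nat add_eq_0_iff2)
    show "z - of_nat (Suc k) \<noteq> 0" using z
      by (metis Ints_of_nat eq_iff_diff_eq_0)
  qed
  have "(\<lambda>k. (inverse (of_nat (Suc k)) - inverse ((1 - z) + of_nat k))
           - (inverse (of_nat (Suc k)) - inverse ((z + 1) + of_nat k)))
        sums ((\<Sum>k. inverse (of_nat (Suc k)) - inverse ((1 - z) + of_nat k))
           - (\<Sum>k. inverse (of_nat (Suc k)) - inverse ((z + 1) + of_nat k)))"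
    by (intro sums_diff summable_sums summable_Digamma nz)
  also have "(\<lambda>k. (inverse (of_nat (Suc k)) - inverse ((1 - z) + of_nat k))
           - (inverse (of_nat (Suc k)) - inverse ((z + 1) + of_nat k)))
       = (\<lambda>k. 2 * z / (z\<^sup>2 - of_nat (Suc k) ^ 2))"
  proof
    fix k :: nat
    have a: "(1 - z) + of_nat k = - (z - of_nat (Suc k))" and b: "(z + 1) + of_nat k = z + of_nat (Suc k)"
      by simp_all
    have "z\<^sup>2 - of_nat (Suc k) ^ 2 = (z - of_nat (Suc k)) * (z + of_nat (Suc k))"
      by (simp add: power2_eq_square algebra_simps)
    then show "(inverse (of_nat (Suc k)) - inverse ((1 - z) + of_nat k))
           - (inverse (of_nat (Suc k)) - inverse ((z + 1) + of_nat k)) = 2 * z / (z\<^sup>2 - of_nat (Suc k) ^ 2)"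
      using ne[of k] unfolding a b inverse_minus_eq
      by (simp add: divide_simps del: of_nat_Suc) (simp add: algebra_simps del: of_nat_Suc)
  qed
  also have "((\<Sum>k. inverse (of_nat (Suc k)) - inverse ((1 - z) + of_nat k))
           - (\<Sum>k. inverse (of_nat (Suc k)) - inverse ((z + 1) + of_nat k)))
        = Digamma (1 - z) - Digamma (z + 1)"
    by (simp add: Digamma_def)
  also have "\<dots> = of_real pi * cot (of_real pi * z) - 1 / z"
    by (simp add: cot_digamma[OF z] Digamma_plus1[OF nz(1)])
  finally have sums: "(\<lambda>k. 2 * z / (z\<^sup>2 - of_nat (Suc k) ^ 2)) sums (of_real pi * cot (of_real pi * z) - 1 / z)" .
  have "summable (\<lambda>k. norm (2 * z / (z\<^sup>2 - of_nat (Suc k) ^ 2)))"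
  proof (rule summable_comparison_test_ev)
    show "summable (\<lambda>k. 4 * norm z * (1 / real (Suc k) ^ 2))"
      using inverse_power_summable[of 2, where 'a=real]
      by (intro summable_mult) (subst summable_Suc_iff, simp add: inverse_eq_divide)
    \<comment> \<open>From this index on, (k + 1)^2 is at least 2 |z|^2, so the denominator has norm
      at least (k + 1)^2 / 2; this is where the factor 4 in the majorant comes from.\<close>
    obtain N where N: "2 * (norm z)\<^sup>2 + 1 < real N" using reals_Archimedean2 by blast
    show "\<forall>\<^sub>F k in sequentially. norm (norm (2 * z / (z\<^sup>2 - of_nat (Suc k) ^ 2))) \<le> 4 * norm z * (1 / real (Suc k) ^ 2)"
      using eventually_ge_at_top[of N]
    proof eventually_elim
      case (elim k)
      have "real (Suc k) \<le> real (Suc k) ^ 2" by (simp add: power2_eq_square)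
      then have "2 * (norm z)\<^sup>2 \<le> real (Suc k) ^ 2" using N elim by simp
      moreover have "norm (of_nat (Suc k) ^ 2 - z\<^sup>2) \<ge> norm (of_nat (Suc k) ^ 2 :: complex) - norm (z\<^sup>2)"
        by (rule norm_triangle_ineq2)
      ultimately have "norm (z\<^sup>2 - of_nat (Suc k) ^ 2) \<ge> real (Suc k) ^ 2 / 2"
        by (simp add: norm_minus_commute norm_power del: of_nat_Suc)
      moreover have "real (Suc k) ^ 2 > 0" by simp
      ultimately have "norm (2 * z) / norm (z\<^sup>2 - of_nat (Suc k) ^ 2) \<le> norm (2 * z) / (real (Suc k) ^ 2 / 2)"
        by (intro divide_left_mono mult_pos_pos) (auto simp del: of_nat_Suc)
      then show ?case by (simp add: norm_divide norm_mult del: of_nat_Suc)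
    qed
  qed
  then have "((\<lambda>k. 2 * z / (z\<^sup>2 - of_nat (Suc k) ^ 2)) has_sum (of_real pi * cot (of_real pi * z) - 1 / z)) UNIV"
    by (rule norm_summable_imp_has_sum[OF _ sums])
  then show ?thesis by (subst has_sum_from_1_iff)
qed

section \<open>Arithmetic and interchange of unconditional sums\<close>

lemma has_sum_diff:
  fixes f g :: "'a \<Rightarrow> 'b :: topological_ab_group_add"
  assumes "(f has_sum a) A" "(g has_sum b) A"
  shows "((\<lambda>x. f x - g x) has_sum (a - b)) A"
  using has_sum_add[OF assms(1), of "\<lambda>x. - g x" "- b"] assms(2) by (simp add: has_sum_uminus)

lemma has_sum_finite_sum:
  fixes f :: "'i \<Rightarrow> 'a \<Rightarrow> 'b :: topological_comm_monoid_add"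
  assumes "\<And>i. i \<in> I \<Longrightarrow> (f i has_sum S i) A"
  shows "((\<lambda>x. \<Sum>i\<in>I. f i x) has_sum (\<Sum>i\<in>I. S i)) A"
  using assms by (induction I rule: infinite_finite_induct) (auto intro: has_sum_add)

lemma summable_on_product_real:
  fixes f :: "'a \<Rightarrow> real" and g :: "'b \<Rightarrow> real"
  assumes "f summable_on A" "g summable_on B"
    and "\<And>x. x \<in> A \<Longrightarrow> f x \<ge> 0" "\<And>y. y \<in> B \<Longrightarrow> g y \<ge> 0"
  shows "(\<lambda>(x, y). f x * g y) summable_on A \<times> B"
proof (rule summable_on_SigmaI)
  show "((\<lambda>y. case (x, y) of (x, y) \<Rightarrow> f x * g y) has_sum f x * infsum g B) B" for x
    using has_sum_cmult_right[OF has_sum_infsum[OF assms(2)], of "f x"] by simp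
  show "(\<lambda>x. f x * infsum g B) summable_on A"
    by (rule summable_on_cmult_left[OF assms(1)])
qed (use assms in auto)

text \<open>Fubini: with summability on the product, both iterated sums equal the double sum, so the
  total computed by rows is inherited by the column sums.\<close>

lemma has_sum_swap_iterated:
  fixes f :: "'a \<Rightarrow> 'b \<Rightarrow> complex"
  assumes "(\<lambda>(x, y). f x y) summable_on A \<times> B"
    and "\<And>x. x \<in> A \<Longrightarrow> ((\<lambda>y. f x y) has_sum r x) B"
    and "\<And>y. y \<in> B \<Longrightarrow> ((\<lambda>x. f x y) has_sum c y) A"
    and "(r has_sum S) A"
  shows "(c has_sum S) B"
proof -
  have "((\<lambda>(x, y). f x y) has_sum S) (A \<times> B)"
    by (rule has_sum_SigmaI) (use assms in auto)
  then have "((\<lambda>(y, x). f x y) has_sum S) (B \<times> A)"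
    by (subst (asm) has_sum_swap) (simp add: case_prod_unfold)
  then show ?thesis
    by (rule has_sum_Sigma') (use assms in auto)
qed

section \<open>Even zeta values\<close>

text \<open>An unconditional sum with natural powers, to which the interchange lemmas apply
  directly; for p \<ge> 2 it is tied to \<open>riemann_zeta\<close> by
  \<open>riemann_zeta_of_nat\<close>.\<close>

definition zeta_nat :: "nat \<Rightarrow> complex" where
  "zeta_nat p = (\<Sum>\<^sub>\<infinity>n\<in>{1..}. 1 / of_nat n ^ p)"

lemma has_sum_zeta_nat:
  assumes "p \<ge> 2"
  shows "((\<lambda>n. 1 / of_nat n ^ p) has_sum zeta_nat p) {1..}"
  unfolding zeta_nat_def
proof (rule has_sum_infsum, rule Infinite_Sum.abs_summable_summable)
  show "(\<lambda>n. norm (1 / of_nat n ^ p :: complex)) summable_on {1..}"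
    using summable_on_inverse_power_from_1[OF assms] by (simp add: norm_divide norm_power)
qed

lemma riemann_zeta_of_nat:
  assumes "p \<ge> 2"
  shows "riemann_zeta (of_nat p) = zeta_nat p"
proof -
  have "(\<lambda>n. 1 / of_nat (Suc n) ^ p :: complex) sums zeta_nat p"
    using has_sum_zeta_nat[OF assms] by (intro has_sum_imp_sums) (simp only: has_sum_from_1_iff)
  then show ?thesis
    unfolding riemann_zeta_def by (simp add: sums_iff powr_nat' del: of_nat_Suc)
qed

text \<open>Each partial fraction of the cotangent, scaled to z^2 / (m^2 - z^2), is a geometric
  series in z^2 / m^2; interchanging the sums over m and j collects the even zeta values.\<close>

lemma zeta_even_geometric:
  fixes z :: complex
  assumes z: "norm z < 1" "z \<noteq> 0"
  shows "((\<lambda>j. zeta_nat (2 * j) * z ^ (2 * j)) has_sum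
           ((1 - of_real pi * z * cot (of_real pi * z)) / 2)) {1..}"
proof -
  have zI: "z \<notin> \<int>"
  proof
    assume "z \<in> \<int>"
    then obtain k where "z = of_int k" by (auto elim: Ints_cases)
    then show False using z by (simp add: norm_of_int)
  qed
  have zm: "norm (z\<^sup>2 / of_nat m ^ 2) < 1" if "m \<in> {1..}" for m
  proof -
    have "norm (z\<^sup>2) < 1" using z by (simp add: norm_power power_less_one_iff)
    also have "1 \<le> real m ^ 2" using that by simp
    finally show ?thesis using that by (simp add: norm_divide norm_power)
  qed
  have "((\<lambda>j. zeta_nat (2 * j) * z ^ (2 * j)) has_sum
           (- z / 2) * (of_real pi * cot (of_real pi * z) - 1 / z)) {1..}"
  proof (rule has_sum_swap_iterated)
    show "(\<lambda>(m, j). (z\<^sup>2 / of_nat m ^ 2) ^ j) summable_on {1..} \<times> {1::nat..}"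
    proof (rule Infinite_Sum.abs_summable_summable, rule Infinite_Sum.abs_summable_on_comparison_test')
      show "(\<lambda>(m, j). (1 / real m ^ 2) * (norm z ^ 2) ^ j) summable_on {1..} \<times> {1..}"
      proof (rule summable_on_product_real)
        have "norm (norm z ^ 2) < 1" using z by (simp add: power_less_one_iff)
        then show "(\<lambda>j. (norm z ^ 2) ^ j) summable_on {1..}"
          using has_sum_geometric_from_1 has_sum_imp_summable by blast
      qed (auto intro: summable_on_inverse_power_from_1[of 2, simplified])
      \<comment> \<open>Because m and j are at least 1, (1/m^2)^j is at most 1/m^2, which separates
        the majorant into a function of m times a function of j.\<close>
      show "norm (case x of (m, j) \<Rightarrow> (z\<^sup>2 / of_nat m ^ 2) ^ j) \<le> (case x of (m, j) \<Rightarrow> (1 / real m ^ 2) * (norm z ^ 2) ^ j)"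
        if x0: "x \<in> {1..} \<times> {1..}" for x
      proof -
        obtain m j where x: "x = (m, j)" "m \<ge> 1" "j \<ge> 1" using x0 by (cases x) auto
        have "(1 / real m ^ 2) ^ j \<le> (1 / real m ^ 2) ^ 1"
          using x by (intro power_decreasing) auto
        then have "(1 / real m ^ 2) ^ j * (norm z ^ 2) ^ j \<le> (1 / real m ^ 2) * (norm z ^ 2) ^ j"
          by (intro mult_right_mono) auto
        then show ?thesis
          by (simp add: x norm_power norm_divide power_divide)
      qed
    qed
    show "((\<lambda>j. (z\<^sup>2 / of_nat m ^ 2) ^ j) has_sum (- z / 2) * (2 * z / (z\<^sup>2 - of_nat m ^ 2))) {1..}"
      if m: "m \<in> {1..}" for m :: nat
    proof -
      have ne: "of_nat m \<noteq> (0::complex)" "z\<^sup>2 \<noteq> of_nat m ^ 2"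
        using m zm[OF m] by (auto simp: divide_simps)
      have "z\<^sup>2 / of_nat m ^ 2 / (1 - z\<^sup>2 / of_nat m ^ 2) = - (z\<^sup>2 / (z\<^sup>2 - of_nat m ^ 2))"
        using ne by (simp add: divide_simps) (simp add: algebra_simps)
      with has_sum_geometric_from_1[OF zm[OF m]] show ?thesis
        by (simp add: power2_eq_square)
    qed
    show "((\<lambda>m. (z\<^sup>2 / of_nat m ^ 2) ^ j) has_sum zeta_nat (2 * j) * z ^ (2 * j)) {1..}"
      if "j \<in> {1..}" for j :: nat
      using has_sum_cmult_left[OF has_sum_zeta_nat[of "2 * j"], of "z ^ (2 * j)"] that
      by (simp add: power_divide power_mult)
    show "((\<lambda>m. (- z / 2) * (2 * z / (z\<^sup>2 - of_nat m ^ 2))) has_sum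
           (- z / 2) * (of_real pi * cot (of_real pi * z) - 1 / z)) {1..}"
      by (intro has_sum_cmult_right cot_partial_fractions zI)
  qed
  also have "(- z / 2) * (of_real pi * cot (of_real pi * z) - 1 / z)
     = (1 - of_real pi * z * cot (of_real pi * z)) / 2"
    using z by (simp add: field_simps)
  finally show ?thesis .
qed

section \<open>Bernoulli numbers from the generating function t / (exp t - 1)\<close>

lemma cot_exp_complex: "cot w = \<i> * (exp (2 * \<i> * w) + 1) / (exp (2 * \<i> * w) - 1)" for w :: complex
proof -
  have e: "exp (2 * \<i> * w) = exp (\<i> * w) * exp (\<i> * w)" by (simp add: mult.assoc flip: exp_add)
  have m: "exp (- (\<i> * w)) = inverse (exp (\<i> * w))" by (rule exp_minus)
  have nz: "exp (\<i> * w) \<noteq> 0" by simp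
  show ?thesis
    unfolding cot_def sin_exp_eq cos_exp_eq e m using nz
    by (simp add: divide_simps)
qed

text \<open>The divisor has constant term 0 and is no unit, but it has subdegree 1 and so divides
  \<open>fps_X\<close> exactly. The resulting real convolution identity is transferred to complex
  coefficients one at a time.\<close>

lemma bernoulli_fps:
  "Abs_fps (\<lambda>n. of_real (bernoulli n / fact n)) * (fps_exp 1 - 1) = (fps_X :: complex fps)"
proof (rule fps_ext)
  fix n
  let ?E = "fps_exp 1 - 1 :: real fps"
  have "subdegree ?E = 1" by (rule subdegreeI) auto
  then have "?E dvd fps_X" by (subst fps_dvd_iff) (auto simp: fps_eq_iff intro!: exI[of _ 1])
  then have "fps_X / ?E * ?E = fps_X" by (rule dvd_div_mult_self)
  then have "fps_nth (fps_X / ?E * ?E) n = fps_nth fps_X n" by simp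
  then have "of_real (\<Sum>i=0..n. bernoulli i / fact i * fps_nth ?E (n - i)) = (of_real (fps_nth fps_X n) :: complex)"
    by (simp add: fps_mult_nth bernoulli_def)
  then show "fps_nth (Abs_fps (\<lambda>n. of_real (bernoulli n / fact n)) * (fps_exp 1 - 1)) n = fps_nth (fps_X :: complex fps) n"
    by (simp add: fps_mult_nth fps_one_nth if_distrib cong: if_cong)
qed

lemma exp_neq_1:
  fixes t :: complex
  assumes t: "norm t < 2 * pi" "t \<noteq> 0"
  shows "exp t \<noteq> 1"
proof
  assume "exp t = 1"
  then obtain n :: int where n: "Re t = 0" "Im t = of_int (2 * n) * pi" by (auto simp: exp_eq_1)
  then have "norm t = 2 * pi * \<bar>of_int n\<bar>" by (simp add: cmod_def abs_mult)
  then have "\<bar>of_int n :: real\<bar> < 1" using t by simp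
  then have "n = 0" by linarith
  then show False using n t by (simp add: complex_eq_iff)
qed

text \<open>
  With \<open>t = 2\<pi>iz\<close> one has \<open>t/(exp t - 1) = -t/2 + \<pi>z cot (\<pi>z)\<close>, and the cotangent
  contributes \<open>1 - 2 (\<Sum>j\<ge>1. \<zeta>(2j) z\<^sup>2\<^sup>j)\<close>.
\<close>

definition zeta_fps :: "complex fps" where
  "zeta_fps = Abs_fps (\<lambda>n. (if n = 0 then 1 else 0) + (if n = 1 then - 1 / 2 else 0)
      + (if n \<in> (*) 2 ` {1..} then - 2 * zeta_nat n / (2 * of_real pi * \<i>) ^ n else 0))"

lemma zeta_fps_sums:
  fixes t :: complex
  assumes t: "norm t < 2 * pi" "t \<noteq> 0"
  shows "(\<lambda>n. fps_nth zeta_fps n * t ^ n) sums (t / (exp t - 1))"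
proof -
  define z where "z = t / (2 * of_real pi * \<i>)"
  have z: "norm z < 1" "z \<noteq> 0" using t by (auto simp: z_def norm_divide norm_mult)
  have exp1: "exp t \<noteq> 1" using exp_neq_1 t by blast
  have "((\<lambda>j. - 2 * zeta_nat (2 * j) / (2 * of_real pi * \<i>) ^ (2 * j) * t ^ (2 * j)) has_sum
           - 2 * ((1 - of_real pi * z * cot (of_real pi * z)) / 2)) {1..}"
    using has_sum_cmult_right[OF zeta_even_geometric[OF z], of "-2"]
    by (simp add: z_def power_divide mult_ac)
  then have "((\<lambda>n. - 2 * zeta_nat n / (2 * of_real pi * \<i>) ^ n * t ^ n) has_sum
           - 2 * ((1 - of_real pi * z * cot (of_real pi * z)) / 2)) ((*) 2 ` {1..})"
    by (subst has_sum_reindex) (auto simp: inj_on_def o_def)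
  then have "((\<lambda>n. if n \<in> (*) 2 ` {1..} then - 2 * zeta_nat n / (2 * of_real pi * \<i>) ^ n * t ^ n else 0) has_sum
           - 2 * ((1 - of_real pi * z * cot (of_real pi * z)) / 2)) UNIV"
    by (rule has_sum_cong_neutral[THEN iffD1, rotated 3]) auto
  then have "(\<lambda>n. ((if n = 0 then 1 else 0) + (if n = 1 then - t / 2 else 0)) +
       (if n \<in> (*) 2 ` {1..} then - 2 * zeta_nat n / (2 * of_real pi * \<i>) ^ n * t ^ n else 0)) sums
         ((1 + - t / 2) + - 2 * ((1 - of_real pi * z * cot (of_real pi * z)) / 2))"
    by (intro sums_add has_sum_imp_sums sums_single)
  moreover have "(1 + - t / 2) + - 2 * ((1 - of_real pi * z * cot (of_real pi * z)) / 2) = t / (exp t - 1)"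
  proof -
    have pz: "of_real pi * z = - \<i> * t / 2" by (simp add: z_def field_simps)
    have "2 * \<i> * (of_real pi * z) = t" unfolding pz by simp
    then have c: "cot (of_real pi * z) = \<i> * (exp t + 1) / (exp t - 1)" by (subst cot_exp_complex) simp
    have "exp t - 1 \<noteq> 0" using exp1 by simp
    then show ?thesis unfolding c unfolding pz by (simp add: field_simps)
  qed
  moreover have "(\<lambda>n. ((if n = 0 then 1 else 0) + (if n = 1 then - t / 2 else 0)) +
       (if n \<in> (*) 2 ` {1..} then - 2 * zeta_nat n / (2 * of_real pi * \<i>) ^ n * t ^ n else 0))
      = (\<lambda>n. fps_nth zeta_fps n * t ^ n)"
    by (auto simp: zeta_fps_def fun_eq_iff)
  ultimately show ?thesis by simp
qed

text \<open>A convergent power series is determined by its function near 0: the function expanded by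
  \<open>zeta_fps\<close>, times exp t - 1, is t there.\<close>

lemma zeta_fps_mult: "zeta_fps * (fps_exp 1 - 1) = fps_X"
proof -
  \<comment> \<open>The value 1 at the origin fills the removable singularity and agrees with the
    constant coefficient of \<open>zeta_fps\<close>.\<close>
  define f where "f t = (if t = 0 then 1 else t / (exp t - 1))" for t :: complex
  have ev: "\<forall>\<^sub>F t in nhds (0::complex). norm t < 2 * pi"
    by (rule order_tendstoD) (auto intro!: tendsto_eq_intros filterlim_ident)
  have "f has_fps_expansion zeta_fps"
  proof (rule has_fps_expansionI)
    show "\<forall>\<^sub>F t in nhds 0. (\<lambda>n. fps_nth zeta_fps n * t ^ n) sums f t"
      using ev
    proof eventually_elim
      case (elim t)
      show ?case
      proof (cases "t = 0")
        case True
        have "(\<lambda>n. fps_nth zeta_fps n * 0 ^ n) sums fps_nth zeta_fps 0"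
          by (rule powser_sums_zero)
        then show ?thesis by (auto simp: True f_def zeta_fps_def)
      qed (use elim zeta_fps_sums in \<open>auto simp: f_def\<close>)
    qed
  qed
  then have "(\<lambda>t. f t * (exp t - 1)) has_fps_expansion (zeta_fps * (fps_exp 1 - 1))"
    by (intro fps_expansion_intros)
  moreover have "\<forall>\<^sub>F t in nhds 0. f t * (exp t - 1) = t"
    using ev
  proof eventually_elim
    case (elim t)
    then show ?case using exp_neq_1[of t] by (auto simp: f_def)
  qed
  ultimately have "(\<lambda>t. t) has_fps_expansion (zeta_fps * (fps_exp 1 - 1))"
    unfolding has_fps_expansion_def by (auto elim: eventually_elim2)
  then show ?thesis
    using has_fps_expansion_fps_X[where 'a = complex] by (metis fps_ext fps_nth_fps_expansion)
qed

text \<open>Both series give \<open>fps_X\<close> when multiplied by the nonzero series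
  \<open>fps_exp 1 - 1\<close>, which cancels.\<close>

lemma fps_nth_zeta_fps: "fps_nth zeta_fps n = of_real (bernoulli n / fact n)"
proof -
  have "fps_exp 1 - 1 \<noteq> (0 :: complex fps)" by (auto simp: fps_eq_iff intro!: exI[of _ 1])
  then have "zeta_fps = Abs_fps (\<lambda>n. of_real (bernoulli n / fact n))"
    using zeta_fps_mult bernoulli_fps by (metis mult_right_cancel)
  from arg_cong[OF this, of "\<lambda>F. fps_nth F n"] show ?thesis
    unfolding fps_nth_Abs_fps .
qed

text \<open>Euler's formula, by comparing the coefficients of t^(2j); the alternating sign comes
  from the power of \<i> in (2\<pi>\<i>)^(2j).\<close>

lemma zeta_nat_even:
  assumes "j \<ge> 1"
  shows "zeta_nat (2 * j) = of_real ((-1) ^ (j + 1) * (2 * pi) ^ (2 * j) / 2 * (bernoulli (2 * j) / fact (2 * j)))"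
proof -
  have "- 2 * zeta_nat (2 * j) / (2 * of_real pi * \<i>) ^ (2 * j) = of_real (bernoulli (2 * j) / fact (2 * j))"
    using fps_nth_zeta_fps[of "2 * j"] assms by (simp add: zeta_fps_def)
  then have "zeta_nat (2 * j) = - ((2 * of_real pi * \<i>) ^ (2 * j)) / 2 * of_real (bernoulli (2 * j) / fact (2 * j))"
    by (simp add: field_simps) (metis minus_minus)
  also have "(2 * of_real pi * \<i>) ^ (2 * j) = (of_real ((-1) ^ j * (2 * pi) ^ (2 * j)) :: complex)"
    by (simp add: power_mult_distrib power_mult[of "\<i>"])
  finally show ?thesis by simp
qed

lemma bernoulli_0: "bernoulli 0 = 1"
proof -
  have "complex_of_real (bernoulli 0) = of_real 1"
    using fps_nth_zeta_fps[of 0] by (simp add: zeta_fps_def image_iff)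
  then show ?thesis by (simp only: of_real_eq_iff)
qed

section \<open>Lambert series at imaginary nomes\<close>

lemma norm_inverse_one_minus_power_le:
  fixes q :: complex
  assumes "norm q < 1" "n \<ge> 1"
  shows "norm (1 / (1 - q ^ n)) \<le> 1 / (1 - norm q)"
proof -
  have "norm q ^ n \<le> norm q ^ 1" using assms by (intro power_decreasing) auto
  then have "1 - norm q \<le> norm (1 - q ^ n)"
    using norm_triangle_ineq2[of 1 "q ^ n"] by (simp add: norm_power)
  then show ?thesis using assms(1)
    by (simp add: norm_divide divide_simps) 
qed

text \<open>The factors 1 / (1 - q^n) are bounded uniformly in n, so a geometric series in |q|
  dominates. The form with natural powers replaces \<open>powr\<close> from here on.\<close>

lemma has_sum_lambert:
  fixes q :: complex
  assumes q: "norm q < 1"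
  shows "((\<lambda>n. q ^ n / (of_nat n ^ p * (1 - q ^ n))) has_sum lambert q (- of_nat p)) {1..}"
proof -
  let ?f = "\<lambda>n. q ^ n / (of_nat n ^ p * (1 - q ^ n))"
  have "norm (?f (Suc n)) \<le> (1 / (1 - norm q)) * norm q ^ n" for n
  proof -
    have "norm (?f (Suc n)) = 1 / real (Suc n) ^ p * norm q ^ Suc n * norm (1 / (1 - q ^ Suc n))"
      by (simp add: norm_divide norm_mult norm_power del: of_nat_Suc power_Suc)
    also have "\<dots> \<le> 1 * norm q ^ n * (1 / (1 - norm q))"
    proof (intro mult_mono norm_inverse_one_minus_power_le q)
      show "norm q ^ Suc n \<le> norm q ^ n" using q by (intro power_decreasing) auto
      show "1 / real (Suc n) ^ p \<le> 1" by (simp add: divide_simps del: of_nat_Suc)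
    qed auto
    finally show ?thesis by simp
  qed
  then have "summable (\<lambda>n. norm (?f (Suc n)))"
    using q by (intro summable_comparison_test'[OF summable_mult[OF summable_geometric], of "norm q" 0 _ "1 / (1 - norm q)"])
      (simp_all del: of_nat_Suc power_Suc)
  moreover have "(\<lambda>n. ?f (Suc n)) = (\<lambda>n. of_nat (Suc n) powr (- of_nat p) * q ^ Suc n / (1 - q ^ Suc n))"
    by (simp add: powr_minus powr_nat' fun_eq_iff divide_simps del: of_nat_Suc power_Suc)
  moreover from this have "lambert q (- of_nat p) = (\<Sum>n. ?f (Suc n))"
    unfolding lambert_def by simp
  ultimately show ?thesis
    by (subst has_sum_from_1_iff, intro norm_summable_imp_has_sum)
       (auto intro!: summable_sums dest: summable_norm_cancel)
qed

text \<open>Extension by zero lets a sum over the multiples of d be added to sums over all positive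
  n.\<close>

lemma has_sum_multiples:
  assumes "((\<lambda>n. f (d * n)) has_sum S) {1::nat..}" "d \<ge> 1"
  shows "((\<lambda>n. if d dvd n then f n else 0) has_sum S) {1..}"
proof -
  have "(f has_sum S) ((*) d ` {1..})"
    using assms by (subst has_sum_reindex) (auto simp: inj_on_def o_def)
  then show ?thesis
    by (rule has_sum_cong_neutral[THEN iffD1, rotated 3]) (use assms(2) in \<open>auto simp: dvd_def image_iff\<close>)
qed

text \<open>The left side collapses to -2 y^2 / (1 + y^2), and 1 + y^2 divides 1 - y^4. This is the
  contribution of odd n, where the n-th powers of \<i> and -\<i> are \<i> and -\<i> in some
  order.\<close>

lemma geometric_odd_identity:
  fixes y :: complex
  assumes "norm y < 1"
  shows "\<i> * y / (1 - \<i> * y) + (- \<i> * y) / (1 - (- \<i> * y)) = - 2 * (y\<^sup>2 / (1 - y\<^sup>2)) + 4 * (y ^ 4 / (1 - y ^ 4))"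
proof -
  have nz: "1 - x \<noteq> 0" if "norm x < 1" for x :: complex using that by auto
  have y2: "norm (y\<^sup>2) < 1" using assms by (simp add: norm_power power_less_one_iff)
  have a: "1 - \<i> * y \<noteq> 0" "1 + \<i> * y \<noteq> 0" "1 - y\<^sup>2 \<noteq> 0" "1 + y\<^sup>2 \<noteq> 0"
    using nz[of "\<i> * y"] nz[of "- (\<i> * y)"] nz[of "y\<^sup>2"] nz[of "- (y\<^sup>2)"] assms y2
    by (simp_all add: norm_mult)
  have b: "1 - y ^ 4 = (1 - y\<^sup>2) * (1 + y\<^sup>2)" "1 + y\<^sup>2 = (1 - \<i> * y) * (1 + \<i> * y)"
    by (simp_all add: algebra_simps power2_eq_square power4_eq_xxxx)
  have "\<i> * y / (1 - \<i> * y) + (- \<i> * y) / (1 - (- \<i> * y)) = - 2 * y\<^sup>2 / (1 + y\<^sup>2)"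
    unfolding b(2) using a by (simp add: divide_simps) (simp add: algebra_simps power2_eq_square)
  also have "\<dots> = - 2 * (y\<^sup>2 / (1 - y\<^sup>2)) + 4 * (y ^ 4 / (1 - y ^ 4))"
    unfolding b(1) using a by (simp add: divide_simps) (simp add: algebra_simps power2_eq_square power4_eq_xxxx)
  finally show ?thesis .
qed

text \<open>Serves the indices n congruent to 2 modulo 4, where both n-th powers are -1.\<close>

lemma geometric_neg_identity:
  fixes y :: complex
  assumes "norm y < 1"
  shows "(- y) / (1 - (- y)) = - (y / (1 - y)) + 2 * (y\<^sup>2 / (1 - y\<^sup>2))"
proof -
  have nz: "1 - x \<noteq> 0" if "norm x < 1" for x :: complex using that by auto
  have a: "1 - y \<noteq> 0" "1 + y \<noteq> 0"
    using nz[of y] nz[of "- y"] assms by simp_all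
  have b: "1 - y\<^sup>2 = (1 - y) * (1 + y)"
    by (simp add: algebra_simps power2_eq_square)
  show ?thesis
    unfolding b using a by (simp add: divide_simps) (simp add: algebra_simps power2_eq_square)
qed

text \<open>The term at n depends on n modulo 4 only through (\<plusminus>\<i>)^n. Restricting a
  Lambert series to n = d n' raises its nome to the power d and costs a factor d^(-p), so
  \<open>c\<close> comes from d = 2 and its square from d = 4.\<close>

lemma lambert_imaginary_sum:
  fixes q1 :: real and p :: nat
  assumes q1: "0 \<le> q1" "q1 < 1"
  defines "L \<equiv> \<lambda>m. lambert (of_real (q1 ^ m)) (- of_nat p)" and "c \<equiv> 1 / 2 ^ p :: complex"
  shows "lambert (\<i> * of_real q1) (- of_nat p) + lambert (- \<i> * of_real q1) (- of_nat p) =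
    - 2 * (1 + c) * L 2 + (4 + 6 * c + 4 * c\<^sup>2) * L 4 - 4 * c * (1 + c) * L 8"
proof -
  let ?g = "\<lambda>x n. x / (of_nat n ^ p * (1 - x)) :: complex"
  let ?q = "of_real q1 :: complex"
  define M where "M d f = (\<lambda>n. if d dvd n then f n else 0)" for d :: nat and f :: "nat \<Rightarrow> complex"
  have q1p: "q1 ^ m < 1" if "m \<ge> 1" for m using q1 that by (simp add: power_less_one_iff)
  have L: "((\<lambda>n. ?g (?q ^ (m * n)) n) has_sum L m) {1..}" if "m \<ge> 1" for m
    using has_sum_lambert[of "of_real (q1 ^ m)" p] q1p[OF that] q1 unfolding L_def
    by (simp add: power_mult norm_power)
  have LM: "(M d (\<lambda>n. ?g (?q ^ (m * n)) n) has_sum (1 / of_nat d ^ p * L (m * d))) {1..}" if "m \<ge> 1" "d \<ge> 1" for m d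
  proof -
    have "((\<lambda>n. 1 / of_nat d ^ p * ?g (?q ^ ((m * d) * n)) n) has_sum (1 / of_nat d ^ p * L (m * d))) {1..}"
      using that by (intro has_sum_cmult_right L) auto
    also have "(\<lambda>n. 1 / of_nat d ^ p * ?g (?q ^ ((m * d) * n)) n) = (\<lambda>n. ?g (?q ^ (m * (d * n))) (d * n))"
      by (auto simp: power_mult_distrib mult_ac)
    finally show ?thesis unfolding M_def
      by (rule has_sum_multiples) (use that in auto)
  qed
  \<comment> \<open>The first two terms are right for odd n; the \<open>M 2\<close> terms correct
    them to twice the value at -y on even n, and the \<open>M 4\<close> terms correct that to twice
    the value at y on multiples of 4.\<close>
  let ?T = "\<lambda>n. - 2 * ?g (?q ^ (2 * n)) n + 4 * ?g (?q ^ (4 * n)) n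
      + (2 * M 2 (\<lambda>n. ?g (?q ^ (2 * n)) n) n - 4 * M 2 (\<lambda>n. ?g (?q ^ (4 * n)) n) n
         - 2 * M 2 (\<lambda>n. ?g (?q ^ (1 * n)) n) n + 4 * M 2 (\<lambda>n. ?g (?q ^ (2 * n)) n) n)
      + (4 * M 4 (\<lambda>n. ?g (?q ^ (1 * n)) n) n - 4 * M 4 (\<lambda>n. ?g (?q ^ (2 * n)) n) n)"
  have T: "?g ((\<i> * ?q) ^ n) n + ?g ((- \<i> * ?q) ^ n) n = ?T n" if n: "n \<in> {1..}" for n
  proof -
    define r :: complex where "r = 1 / of_nat n ^ p"
    define G where "G x = x / (1 - x)" for x :: complex
    have g: "?g x n = r * G x" for x by (simp add: r_def G_def)
    define Y where "Y = ?q ^ n"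
    have Y: "norm Y < 1" using q1 q1p[of n] n by (simp add: Y_def norm_power)
    have pw: "?q ^ (1 * n) = Y" "?q ^ (2 * n) = Y\<^sup>2" "?q ^ (4 * n) = Y ^ 4"
      by (simp_all add: Y_def mult.commute flip: power_mult)
    have odd: "G (\<i> * Y) + G (- \<i> * Y) = - 2 * G (Y\<^sup>2) + 4 * G (Y ^ 4)"
      using geometric_odd_identity[OF Y] unfolding G_def .
    have neg: "G (- Y) = - G Y + 2 * G (Y\<^sup>2)"
      using geometric_neg_identity[OF Y] unfolding G_def .
    have "n mod 4 = 0 \<or> n mod 4 = 1 \<or> n mod 4 = 2 \<or> n mod 4 = 3" by auto
    then consider "n mod 4 = 0" | "n mod 4 = 1" | "n mod 4 = 2" | "n mod 4 = 3" by fastforce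
    then have "G ((\<i> * ?q) ^ n) + G ((- \<i> * ?q) ^ n) = - 2 * G (Y\<^sup>2) + 4 * G (Y ^ 4)
      + (if 2 dvd n then 2 * G (Y\<^sup>2) - 4 * G (Y ^ 4) - 2 * G Y + 4 * G (Y\<^sup>2) else 0)
      + (if 4 dvd n then 4 * G Y - 4 * G (Y\<^sup>2) else 0)"
    proof cases
      case 1
      then obtain l where l: "n = 4 * l" by (auto simp: mod_eq_0_iff_dvd)
      have "\<i> ^ n = 1" "(- \<i>) ^ n = 1" by (simp_all add: l power_mult)
      moreover have "2 dvd n" "4 dvd n" using 1 by presburger+
      ultimately show ?thesis by (simp only: power_mult_distrib flip: Y_def) simp
    next
      case 2
      then obtain l where l: "n = 4 * l + 1" by (metis mult.commute div_mult_mod_eq)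
      have "\<i> ^ n = \<i>" "(- \<i>) ^ n = - \<i>" by (simp_all add: l power_mult)
      moreover have "\<not> 2 dvd n" "\<not> 4 dvd n" using 2 by presburger+
      ultimately show ?thesis using odd by (simp only: power_mult_distrib flip: Y_def) simp
    next
      case 3
      then obtain l where l: "n = 4 * l + 2" by (metis mult.commute div_mult_mod_eq)
      have "\<i> ^ n = - 1" "(- \<i>) ^ n = - 1" by (simp_all add: l power_add power_mult)
      moreover have "2 dvd n" "\<not> 4 dvd n" using 3 by presburger+
      ultimately show ?thesis using neg by (simp only: power_mult_distrib flip: Y_def) simp
    next
      case 4
      then obtain l where l: "n = 4 * l + 3" by (metis mult.commute div_mult_mod_eq)
      have "\<i> ^ n = - \<i>" "(- \<i>) ^ n = \<i>" by (simp_all add: l power_add power_mult power3_eq_cube)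
      moreover have "\<not> 2 dvd n" "\<not> 4 dvd n" using 4 by presburger+
      ultimately show ?thesis using odd by (simp only: power_mult_distrib flip: Y_def) (simp add: add.commute)
    qed
    from arg_cong[OF this, of "\<lambda>x. r * x"] show ?thesis
      unfolding M_def g pw by (auto simp: algebra_simps)
  qed
  have c: "1 / of_nat 2 ^ p = c" "1 / of_nat 4 ^ p = c\<^sup>2"
    by (simp_all add: c_def power2_eq_square flip: power_mult_distrib)
  have "(?T has_sum (- 2 * L 2 + 4 * L 4
      + (2 * (c * L (2 * 2)) - 4 * (c * L (4 * 2)) - 2 * (c * L (1 * 2)) + 4 * (c * L (2 * 2)))
      + (4 * (c\<^sup>2 * L (1 * 4)) - 4 * (c\<^sup>2 * L (2 * 4))))) {1..}"
    using LM[of 2 2, unfolded c] LM[of 4 2, unfolded c] LM[of 1 2, unfolded c] LM[of 1 4, unfolded c] LM[of 2 4, unfolded c]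
    by (intro has_sum_add has_sum_diff has_sum_cmult_right L) simp_all
  moreover have "(?T has_sum (lambert (\<i> * of_real q1) (- of_nat p) + lambert (- \<i> * of_real q1) (- of_nat p))) {1..}"
  proof -
    have "((\<lambda>n. ?g ((\<i> * ?q) ^ n) n + ?g ((- \<i> * ?q) ^ n) n) has_sum
        (lambert (\<i> * of_real q1) (- of_nat p) + lambert (- \<i> * of_real q1) (- of_nat p))) {1..}"
      using q1 by (intro has_sum_add has_sum_lambert) (auto simp: norm_mult)
    then show ?thesis by (subst has_sum_cong[OF T[symmetric]])
  qed
  ultimately have "lambert (\<i> * of_real q1) (- of_nat p) + lambert (- \<i> * of_real q1) (- of_nat p)
      = - 2 * L 2 + 4 * L 4
      + (2 * (c * L (2 * 2)) - 4 * (c * L (4 * 2)) - 2 * (c * L (1 * 2)) + 4 * (c * L (2 * 2)))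
      + (4 * (c\<^sup>2 * L (1 * 4)) - 4 * (c\<^sup>2 * L (2 * 4)))"
    using has_sum_unique by blast
  then show ?thesis by (simp add: algebra_simps power2_eq_square flip: numeral_2_eq_2)
qed

section \<open>Reciprocity\<close>

text \<open>The difference of squares factors into n\<tau> + m and n\<tau> - m. The imaginary part
  of either factor controls n, and the triangle inequality then controls m, uniformly in n.\<close>

lemma lattice_norm_bound:
  fixes \<tau> :: complex
  assumes "Im \<tau> > 0"
  obtains c where "c > 0"
    "\<And>n m :: nat. c * real m ^ 2 \<le> norm ((of_nat n * \<tau>)\<^sup>2 - of_nat m ^ 2)"
proof -
  define y where "y = Im \<tau>"
  have y: "y > 0" using assms by (simp add: y_def)
  \<comment> \<open>The second entry of the minimum is the reciprocal of the factor in |m| \<le> (1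
    + |\<tau>| / y) |w|, derived below.\<close>
  define d where "d = min y (1 / (1 + norm \<tau> / y))"
  have pos: "1 + norm \<tau> / y > 0" using y by (simp add: add_pos_nonneg)
  have d: "d > 0" using y pos by (simp add: d_def)
  have A: "d * \<bar>m\<bar> \<le> norm (of_nat n * \<tau> + of_real m)" for n :: nat and m :: real
  proof -
    let ?w = "of_nat n * \<tau> + of_real m"
    have 1: "y * real n \<le> norm ?w"
      using abs_Im_le_cmod[of ?w] y by (simp add: y_def mult.commute)
    have "\<bar>m\<bar> = norm (?w - of_nat n * \<tau>)" by simp
    also have "\<dots> \<le> norm ?w + real n * norm \<tau>"
      using norm_triangle_ineq4[of ?w "of_nat n * \<tau>"] by (simp add: norm_mult)
    also have "real n * norm \<tau> = (norm \<tau> / y) * (y * real n)" using y by simp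
    also have "\<dots> \<le> (norm \<tau> / y) * norm ?w" using y 1 by (intro mult_left_mono) auto
    finally have "\<bar>m\<bar> \<le> (1 + norm \<tau> / y) * norm ?w" by (simp add: algebra_simps)
    then have "(1 / (1 + norm \<tau> / y)) * \<bar>m\<bar> \<le> norm ?w"
      using pos by (simp add: divide_simps mult.commute)
    moreover have "d * \<bar>m\<bar> \<le> (1 / (1 + norm \<tau> / y)) * \<bar>m\<bar>"
      by (intro mult_right_mono) (auto simp: d_def)
    ultimately show "d * \<bar>m\<bar> \<le> norm ?w" by linarith
  qed
  have B: "norm ((of_nat n * \<tau>)\<^sup>2 - of_nat m ^ 2)
      = norm (of_nat n * \<tau> + of_real (real m)) * norm (of_nat n * \<tau> + of_real (- real m))" for n m :: nat
    by (simp add: algebra_simps power2_eq_square flip: norm_mult)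
  show ?thesis
  proof (rule that[of "d\<^sup>2"])
    show "d\<^sup>2 > 0" using d by simp
    fix n m :: nat
    have "(d * \<bar>real m\<bar>) * (d * \<bar>- real m\<bar>) \<le> norm ((of_nat n * \<tau>)\<^sup>2 - of_nat m ^ 2)"
      unfolding B using d by (intro mult_mono A) auto
    then show "d\<^sup>2 * real m ^ 2 \<le> norm ((of_nat n * \<tau>)\<^sup>2 - of_nat m ^ 2)"
      by (simp add: power2_eq_square mult_ac)
  qed
qed

text \<open>The inner sum over m is the cotangent expansion at n\<tau>. Written in q^n, \<pi>
  cot(\<pi>n\<tau>) is -\<pi>\<i> (1 + 2 q^n / (1 - q^n)), so summing over n gives the odd zeta
  value and the Lambert series; the correction 1 / (n\<tau>) gives the even zeta value.\<close>

lemma lattice_sum: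
  fixes \<tau> :: complex and K :: nat
  assumes \<tau>: "Im \<tau> > 0" and K: "K \<ge> 1"
  shows "((\<lambda>(n, m). 1 / (of_nat n ^ (2 * K) * ((of_nat n * \<tau>)\<^sup>2 - of_nat m ^ 2))) has_sum
     ((- of_real pi * \<i> * (zeta_nat (2 * K + 1) + 2 * lambert (exp (2 * of_real pi * \<i> * \<tau>)) (- of_nat (2 * K + 1)))
        - zeta_nat (2 * K + 2) / \<tau>) / (2 * \<tau>))) ({1..} \<times> {1..})"
proof (rule has_sum_SigmaI)
  define q where "q = exp (2 * of_real pi * \<i> * \<tau>)"
  have q: "norm q < 1" using \<tau> by (simp add: q_def norm_exp_eq_Re)
  have \<tau>0: "\<tau> \<noteq> 0" using \<tau> by auto
  let ?f = "\<lambda>(n, m). 1 / (of_nat n ^ (2 * K) * ((of_nat n * \<tau>)\<^sup>2 - of_nat m ^ 2)) :: complex"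
  let ?r = "\<lambda>n. 1 / (2 * \<tau>) * (1 / of_nat n ^ (2 * K + 1) * (of_real pi * cot (of_real pi * (of_nat n * \<tau>)) - 1 / (of_nat n * \<tau>)))"
  show "((\<lambda>m. ?f (n, m)) has_sum ?r n) {1..}" if n: "n \<in> {1..}" for n
  proof -
    have "of_nat n * \<tau> \<notin> \<int>"
    proof
      assume "of_nat n * \<tau> \<in> \<int>"
      then obtain k where "of_nat n * \<tau> = of_int k" by (elim Ints_cases)
      then have "Im (of_nat n * \<tau>) = Im (of_int k)" by simp
      then show False using \<tau> n by simp
    qed
    from has_sum_cmult_right[OF has_sum_cmult_right[OF cot_partial_fractions[OF this], of "1 / of_nat n ^ (2 * K + 1)"], of "1 / (2 * \<tau>)"]
    show ?thesis
      by (rule has_sum_cong[THEN iffD1, rotated]) (use \<tau>0 n in \<open>simp add: divide_simps\<close>)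
  qed
  show "(?r has_sum (- of_real pi * \<i> * (zeta_nat (2 * K + 1) + 2 * lambert q (- of_nat (2 * K + 1)))
        - zeta_nat (2 * K + 2) / \<tau>) / (2 * \<tau>)) {1..}"
  proof -
    have "((\<lambda>n. 1 / (2 * \<tau>) * (- of_real pi * \<i> * (1 / of_nat n ^ (2 * K + 1) + 2 * (q ^ n / (of_nat n ^ (2 * K + 1) * (1 - q ^ n))))
          - 1 / \<tau> * (1 / of_nat n ^ (2 * K + 2)))) has_sum
       1 / (2 * \<tau>) * (- of_real pi * \<i> * (zeta_nat (2 * K + 1) + 2 * lambert q (- of_nat (2 * K + 1)))
        - 1 / \<tau> * zeta_nat (2 * K + 2))) {1..}"
      by (intro has_sum_diff has_sum_cmult_right has_sum_add has_sum_zeta_nat has_sum_lambert q) (use K in auto)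
    moreover have "1 / (2 * \<tau>) * (- of_real pi * \<i> * (1 / of_nat n ^ (2 * K + 1) + 2 * (q ^ n / (of_nat n ^ (2 * K + 1) * (1 - q ^ n))))
          - 1 / \<tau> * (1 / of_nat n ^ (2 * K + 2))) = ?r n" if n: "n \<in> {1..}" for n
    proof -
      have "exp (2 * \<i> * (of_real pi * (of_nat n * \<tau>))) = q ^ n"
        unfolding q_def by (simp add: mult_ac flip: exp_of_nat_mult)
      then have c: "cot (of_real pi * (of_nat n * \<tau>)) = \<i> * (q ^ n + 1) / (q ^ n - 1)"
        by (subst cot_exp_complex) simp
      have qn: "q ^ n - 1 \<noteq> 0" "1 - q ^ n \<noteq> 0"
        using power_less_one_iff[of "norm q" n] q n by (auto simp flip: norm_power)
      have "\<i> * (q ^ n + 1) / (q ^ n - 1) = - \<i> * (1 + 2 * (q ^ n / (1 - q ^ n)))"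
        using qn by (simp add: divide_simps) (simp add: algebra_simps)
      then have c': "cot (of_real pi * (of_nat n * \<tau>)) = - \<i> * (1 + 2 * (q ^ n / (1 - q ^ n)))"
        using c by simp
      have "q ^ n / (of_nat n ^ (2 * K + 1) * (1 - q ^ n)) = 1 / of_nat n ^ (2 * K + 1) * (q ^ n / (1 - q ^ n))"
        "1 / \<tau> * (1 / of_nat n ^ (2 * K + 2)) = 1 / of_nat n ^ (2 * K + 1) * (1 / (of_nat n * \<tau>))"
        by simp_all
      moreover have "1 / (2 * \<tau>) * (- P * \<i> * (N + 2 * (N * x)) - N * y) = 1 / (2 * \<tau>) * (N * (P * (- \<i> * (1 + 2 * x)) - y))"
        for P N x y by (simp add: algebra_simps)
      ultimately show ?thesis unfolding c' by (simp only:)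
    qed
    ultimately show ?thesis by (subst has_sum_cong) auto
  qed
  show "?f summable_on {1..} \<times> {1..}"
  proof -
    obtain c where c: "c > 0" "\<And>n m :: nat. c * real m ^ 2 \<le> norm ((of_nat n * \<tau>)\<^sup>2 - of_nat m ^ 2)"
      using lattice_norm_bound[OF \<tau>] by metis
    show ?thesis
    proof (rule Infinite_Sum.abs_summable_summable, rule Infinite_Sum.abs_summable_on_comparison_test')
      \<comment> \<open>The lattice bound is free of n, so the majorant splits into n^(-2K) times a
        multiple of m^(-2), both summable as K \<ge> 1.\<close>
      show "(\<lambda>(n, m). (1 / real n ^ (2 * K)) * (1 / c * (1 / real m ^ 2))) summable_on {1..} \<times> {1..}"
        using c(1) K by (intro summable_on_product_real summable_on_cmult_right summable_on_inverse_power_from_1) auto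
      show "norm (?f x) \<le> (case x of (n, m) \<Rightarrow> (1 / real n ^ (2 * K)) * (1 / c * (1 / real m ^ 2)))"
        if x0: "x \<in> {1..} \<times> {1..}" for x
      proof -
        obtain n m where x: "x = (n, m)" "n \<ge> 1" "m \<ge> 1" using x0 by (cases x) auto
        have pos: "c * real m ^ 2 > 0" using c(1) x by simp
        have "1 / norm ((of_nat n * \<tau>)\<^sup>2 - of_nat m ^ 2) \<le> 1 / (c * real m ^ 2)"
          using c(2)[of m n] pos by (intro frac_le) auto
        then have "(1 / real n ^ (2 * K)) * (1 / norm ((of_nat n * \<tau>)\<^sup>2 - of_nat m ^ 2)) \<le> (1 / real n ^ (2 * K)) * (1 / (c * real m ^ 2))"
          by (intro mult_left_mono) auto
        then show ?thesis by (simp add: x norm_divide norm_mult norm_power)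
      qed
    qed
  qed
qed

text \<open>This is the factorization of u^K - v^K divided by u^K v^K (u - v). It removes the mixed
  denominator u - v and so separates the two lattice variables.\<close>

lemma reciprocal_power_diff:
  fixes u v :: "'a :: field"
  assumes "u \<noteq> 0" "v \<noteq> 0" "u \<noteq> v"
  shows "1 / (u ^ K * (u - v)) - 1 / (v ^ K * (u - v)) = - (\<Sum>i<K. 1 / (u ^ (K - i) * v ^ (i + 1)))"
proof -
  have "(\<Sum>i<K. 1 / (u ^ (K - i) * v ^ (i + 1))) = (\<Sum>i<K. v ^ (K - Suc i) * u ^ i / (u ^ K * v ^ K))"
  proof (rule sum.cong)
    fix i assume "i \<in> {..<K}"
    then have "u ^ K = u ^ (K - i) * u ^ i" "v ^ K = v ^ (i + 1) * v ^ (K - Suc i)"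
      by (simp_all flip: power_add power_Suc)
    then show "1 / (u ^ (K - i) * v ^ (i + 1)) = v ^ (K - Suc i) * u ^ i / (u ^ K * v ^ K)"
      using assms by simp
  qed simp
  also have "\<dots> = (\<Sum>i<K. v ^ (K - Suc i) * u ^ i) / (u ^ K * v ^ K)"
    by (simp add: sum_divide_distrib)
  also have "(\<Sum>i<K. v ^ (K - Suc i) * u ^ i) = (u ^ K - v ^ K) / (u - v)"
    using power_diff_sumr2[of u K v] assms by simp
  finally have S: "(\<Sum>i<K. 1 / (u ^ (K - i) * v ^ (i + 1))) = (u ^ K - v ^ K) / (u - v) / (u ^ K * v ^ K)" .
  show ?thesis unfolding S using assms by (simp add: divide_simps)
qed

text \<open>The lattice sums with weights n^(-2K) and m^(-2K) are combined so that the partial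
  fraction identity turns their difference into products of even zeta values. The extreme terms j =
  0 and j = K + 1 come from the value at 2K + 2 occurring in both lattice sums.\<close>

theorem lambert_reciprocity:
  fixes \<tau> :: complex and K :: nat
  assumes \<tau>: "Im \<tau> > 0" and K: "K \<ge> 1"
  defines "\<psi> \<equiv> \<lambda>\<tau>. zeta_nat (2 * K + 1) + 2 * lambert (exp (2 * of_real pi * \<i> * \<tau>)) (- of_nat (2 * K + 1))"
  defines "b \<equiv> \<lambda>j. of_real (bernoulli (2 * j) / fact (2 * j)) :: complex"
  shows "\<i> * \<tau> * (\<psi> \<tau> - \<tau> ^ (2 * K) * \<psi> (- 1 / \<tau>)) =
    (-1) ^ (K + 1) * (2 * of_real pi) ^ (2 * K + 1) * (\<Sum>j\<le>K + 1. b j * b (K + 1 - j) * \<tau> ^ (2 * j))"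
proof -
  have \<tau>0: "\<tau> \<noteq> 0" using \<tau> by auto
  have \<tau>': "Im (- 1 / \<tau>) > 0" using \<tau> by (simp add: Im_divide divide_simps sum_power2_gt_zero_iff)
  define D where "D n m = (of_nat n * \<tau>)\<^sup>2 - of_nat m ^ 2" for n m :: nat
  let ?A = "{1::nat..} \<times> {1::nat..}"
  let ?X1 = "(- of_real pi * \<i> * \<psi> \<tau> - zeta_nat (2 * K + 2) / \<tau>) / (2 * \<tau>)"
  let ?X2 = "(- of_real pi * \<i> * \<psi> (- 1 / \<tau>) + zeta_nat (2 * K + 2) * \<tau>) / (2 * \<tau>)"
  have S1: "((\<lambda>(n, m). 1 / (of_nat n ^ (2 * K) * D n m)) has_sum ?X1) ?A"
    using lattice_sum[OF \<tau> K] by (simp add: D_def \<psi>_def)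
  have S2: "((\<lambda>(n, m). 1 / (of_nat m ^ (2 * K) * D n m)) has_sum ?X2) ?A"
  proof -
    \<comment> \<open>The second series is the first at -1/\<tau> with the variables exchanged:
      (m/\<tau>)^2 - n^2 equals -\<open>D n m\<close> / \<tau>^2, which explains the later factor
      -1/\<tau>^2.\<close>
    have "((\<lambda>(m, n). 1 / (of_nat m ^ (2 * K) * ((of_nat m * (- 1 / \<tau>))\<^sup>2 - of_nat n ^ 2))) has_sum
       ((- of_real pi * \<i> * \<psi> (- 1 / \<tau>) - zeta_nat (2 * K + 2) / (- 1 / \<tau>)) / (2 * (- 1 / \<tau>)))) ?A"
      using lattice_sum[OF \<tau>' K] by (simp add: \<psi>_def)
    then have "((\<lambda>(n, m). 1 / (of_nat m ^ (2 * K) * ((of_nat m * (- 1 / \<tau>))\<^sup>2 - of_nat n ^ 2))) has_sum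
       ((- of_real pi * \<i> * \<psi> (- 1 / \<tau>) - zeta_nat (2 * K + 2) / (- 1 / \<tau>)) / (2 * (- 1 / \<tau>)))) ?A"
      by (subst (asm) has_sum_swap) (simp add: case_prod_unfold)
    from has_sum_cmult_right[OF this, of "- 1 / \<tau>\<^sup>2"]
    have "((\<lambda>x. - 1 / \<tau>\<^sup>2 * (case x of (n, m) \<Rightarrow> 1 / (of_nat m ^ (2 * K) * ((of_nat m * (- 1 / \<tau>))\<^sup>2 - of_nat n ^ 2)))) has_sum
       - 1 / \<tau>\<^sup>2 * ((- of_real pi * \<i> * \<psi> (- 1 / \<tau>) - zeta_nat (2 * K + 2) / (- 1 / \<tau>)) / (2 * (- 1 / \<tau>)))) ?A" .
    moreover have "- 1 / \<tau>\<^sup>2 * ((- of_real pi * \<i> * \<psi> (- 1 / \<tau>) - zeta_nat (2 * K + 2) / (- 1 / \<tau>)) / (2 * (- 1 / \<tau>))) = ?X2"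
      using \<tau>0 by (simp add: divide_simps power2_eq_square)
    moreover have "- 1 / \<tau>\<^sup>2 * (1 / (of_nat m ^ (2 * K) * ((of_nat m * (- 1 / \<tau>))\<^sup>2 - of_nat n ^ 2))) = 1 / (of_nat m ^ (2 * K) * D n m)" for n m
    proof -
      have "D n m = - (\<tau>\<^sup>2 * ((of_nat m * (- 1 / \<tau>))\<^sup>2 - of_nat n ^ 2))"
        unfolding D_def using \<tau>0 by (simp add: power_divide power_mult_distrib algebra_simps)
      then show ?thesis by simp
    qed
    then have "(\<lambda>x. - 1 / \<tau>\<^sup>2 * (case x of (n, m) \<Rightarrow> 1 / (of_nat m ^ (2 * K) * ((of_nat m * (- 1 / \<tau>))\<^sup>2 - of_nat n ^ 2))))
       = (\<lambda>(n, m). 1 / (of_nat m ^ (2 * K) * D n m))"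
      by (intro ext) (simp only: case_prod_unfold)
    ultimately show ?thesis by (simp only:)
  qed
  let ?Z = "\<lambda>i. zeta_nat (2 * (K - i)) * zeta_nat (2 * (i + 1))"
  have S3: "((\<lambda>(n, m). 1 / of_nat n ^ (2 * (K - i)) * (1 / of_nat m ^ (2 * (i + 1)))) has_sum ?Z i) ?A" if "i < K" for i
  proof (rule has_sum_SigmaI)
    show "((\<lambda>m. case (n, m) of (n, m) \<Rightarrow> 1 / of_nat n ^ (2 * (K - i)) * (1 / of_nat m ^ (2 * (i + 1)))) has_sum
        (1 / of_nat n ^ (2 * (K - i)) * zeta_nat (2 * (i + 1)))) {1..}" for n :: nat
      using has_sum_cmult_right[OF has_sum_zeta_nat[of "2 * (i + 1)"], of "1 / of_nat n ^ (2 * (K - i))"] by simp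
    show "((\<lambda>n. 1 / of_nat n ^ (2 * (K - i)) * zeta_nat (2 * (i + 1))) has_sum ?Z i) {1..}"
      using that by (intro has_sum_cmult_left has_sum_zeta_nat) auto
    have "(\<lambda>(n, m). (1 / real n ^ (2 * (K - i))) * (1 / real m ^ (2 * (i + 1)))) summable_on ?A"
      using that by (intro summable_on_product_real summable_on_inverse_power_from_1) auto
    then have "(\<lambda>x. norm (case x of (n, m) \<Rightarrow> 1 / of_nat n ^ (2 * (K - i)) * (1 / complex_of_nat m ^ (2 * (i + 1))))) summable_on ?A"
      by (simp add: case_prod_unfold norm_mult norm_divide norm_power)
    then show "(\<lambda>(n, m). 1 / of_nat n ^ (2 * (K - i)) * (1 / of_nat m ^ (2 * (i + 1))) :: complex) summable_on ?A"
      by (rule Infinite_Sum.abs_summable_summable)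
  qed
  have "((\<lambda>x. (\<Sum>i<K. (- (\<tau> ^ (2 * i))) * (case x of (n, m) \<Rightarrow> 1 / of_nat n ^ (2 * (K - i)) * (1 / of_nat m ^ (2 * (i + 1))))))
       has_sum (\<Sum>i<K. (- (\<tau> ^ (2 * i))) * ?Z i)) ?A"
    by (intro has_sum_finite_sum has_sum_cmult_right S3) auto
  moreover have "(\<Sum>i<K. (- (\<tau> ^ (2 * i))) * (case x of (n, m) \<Rightarrow> 1 / of_nat n ^ (2 * (K - i)) * (1 / of_nat m ^ (2 * (i + 1)))))
     = (case x of (n, m) \<Rightarrow> 1 / (of_nat n ^ (2 * K) * D n m)) - \<tau> ^ (2 * K) * (case x of (n, m) \<Rightarrow> 1 / (of_nat m ^ (2 * K) * D n m))"
    if x0: "x \<in> ?A" for x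
  proof -
    obtain n m where x: "x = (n, m)" "n \<ge> 1" "m \<ge> 1" using x0 by (cases x) auto
    let ?u = "(of_nat n * \<tau>)\<^sup>2" and ?v = "of_nat m ^ 2 :: complex"
    have D0: "D n m \<noteq> 0"
    proof
      obtain c where c: "c > 0" "\<And>n m :: nat. c * real m ^ 2 \<le> norm ((of_nat n * \<tau>)\<^sup>2 - of_nat m ^ 2)"
        using lattice_norm_bound[OF \<tau>] by metis
      assume "D n m = 0"
      then have "c * real m ^ 2 \<le> 0" using c(2)[of m n] by (simp add: D_def)
      then show False using c(1) x by (simp add: mult_le_0_iff)
    qed
    have D: "D n m = ?u - ?v" by (simp add: D_def)
    \<comment> \<open>The power of \<tau> in front cancels the one contained in u^K, leaving the
      plain weight n^(-2K) in the first series and the factor \<tau>^(2K) on the second.\<close>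
    have "\<tau> ^ (2 * K) * (1 / (?u ^ K * (?u - ?v)) - 1 / (?v ^ K * (?u - ?v)))
       = (\<Sum>i<K. - (\<tau> ^ (2 * K)) * (1 / (?u ^ (K - i) * ?v ^ (i + 1))))"
      using x \<tau>0 D0 unfolding D
      by (subst reciprocal_power_diff) (simp_all add: sum_distrib_left sum_negf)
    also have "\<dots> = (\<Sum>i<K. (- (\<tau> ^ (2 * i))) * (1 / of_nat n ^ (2 * (K - i)) * (1 / of_nat m ^ (2 * (i + 1)))))"
    proof (rule sum.cong)
      fix i assume "i \<in> {..<K}"
      then have "2 * K = 2 * i + 2 * (K - i)" by simp
      then have "\<tau> ^ (2 * K) = \<tau> ^ (2 * i) * \<tau> ^ (2 * (K - i))" by (metis power_add)
      moreover have "?u ^ (K - i) = of_nat n ^ (2 * (K - i)) * \<tau> ^ (2 * (K - i))"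
        "?v ^ (i + 1) = of_nat m ^ (2 * (i + 1))"
        by (simp_all only: power_mult_distrib flip: power_mult)
      ultimately show "- (\<tau> ^ (2 * K)) * (1 / (?u ^ (K - i) * ?v ^ (i + 1)))
          = (- (\<tau> ^ (2 * i))) * (1 / of_nat n ^ (2 * (K - i)) * (1 / of_nat m ^ (2 * (i + 1))))"
        using \<tau>0 by (simp only:) simp
    qed simp
    finally have e: "(\<Sum>i<K. (- (\<tau> ^ (2 * i))) * (1 / of_nat n ^ (2 * (K - i)) * (1 / of_nat m ^ (2 * (i + 1)))))
      = \<tau> ^ (2 * K) * (1 / (?u ^ K * (?u - ?v)) - 1 / (?v ^ K * (?u - ?v)))" ..
    have uv: "?u ^ K = of_nat n ^ (2 * K) * \<tau> ^ (2 * K)" "?v ^ K = of_nat m ^ (2 * K)"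
      by (simp_all only: power_mult_distrib flip: power_mult)
    have "t * (1 / (N * t * d) - 1 / (M * d)) = 1 / (N * d) - t * (1 / (M * d))" if "t \<noteq> 0" for t N M d :: complex
      using that by (simp add: right_diff_distrib)
    from this[of "\<tau> ^ (2 * K)"] show ?thesis
      using \<tau>0 unfolding x prod.case D e uv by simp
  qed
  ultimately have "((\<lambda>x. (case x of (n, m) \<Rightarrow> 1 / (of_nat n ^ (2 * K) * D n m)) - \<tau> ^ (2 * K) * (case x of (n, m) \<Rightarrow> 1 / (of_nat m ^ (2 * K) * D n m)))
       has_sum (\<Sum>i<K. (- (\<tau> ^ (2 * i))) * ?Z i)) ?A"
    by (rule has_sum_cong[THEN iffD1, rotated])
  moreover have "((\<lambda>x. (case x of (n, m) \<Rightarrow> 1 / (of_nat n ^ (2 * K) * D n m)) - \<tau> ^ (2 * K) * (case x of (n, m) \<Rightarrow> 1 / (of_nat m ^ (2 * K) * D n m)))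
       has_sum (?X1 - \<tau> ^ (2 * K) * ?X2)) ?A"
    by (intro has_sum_diff has_sum_cmult_right S1 S2)
  ultimately have main: "?X1 - \<tau> ^ (2 * K) * ?X2 = (\<Sum>i<K. (- (\<tau> ^ (2 * i))) * ?Z i)"
    using has_sum_unique by blast
  \<comment> \<open>Common constant of all terms: each Euler formula carries a factor 1/2, and two
    of them doubled leave 1/2; the sign exponents add up to K + 3.\<close>
  let ?c = "(-1) ^ (K + 1) * (2 * of_real pi) ^ (2 * K + 2) / 2 :: complex"
  have Z: "2 * (\<tau> ^ (2 * (i + 1)) * ?Z i) = ?c * (b (i + 1) * b (K + 1 - (i + 1)) * \<tau> ^ (2 * (i + 1)))" if "i < K" for i
  proof -
    have z: "zeta_nat (2 * j) = (-1) ^ (j + 1) * (2 * of_real pi) ^ (2 * j) / 2 * b j" if "j \<ge> 1" for j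
      using zeta_nat_even[OF that] by (simp add: b_def)
    have "K - i + 1 + (i + 1 + 1) = K + 1 + 2" "2 * (K - i) + 2 * (i + 1) = 2 * K + 2" using that by simp_all
    then have "(-1) ^ (K - i + 1) * (-1) ^ (i + 1 + 1) = ((-1) ^ (K + 1) * (-1) ^ 2 :: complex)"
      "(2 * of_real pi) ^ (2 * (K - i)) * (2 * of_real pi) ^ (2 * (i + 1)) = ((2 * of_real pi) ^ (2 * K + 2) :: complex)"
      by (metis power_add)+
    then have "(-1) ^ (K - i + 1) * (-1) ^ (i + 1 + 1) = ((-1) ^ (K + 1) :: complex)"
      "(2 * of_real pi) ^ (2 * (K - i)) * (2 * of_real pi) ^ (2 * (i + 1)) = ((2 * of_real pi) ^ (2 * K + 2) :: complex)"
      by simp_all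
    moreover have "2 * (t * ((s1 * p1 / 2 * b1) * (s2 * p2 / 2 * b2))) = (s1 * s2) * (p1 * p2) / 2 * (b2 * b1 * t)"
      for t s1 p1 b1 s2 p2 b2 :: complex by simp
    ultimately show ?thesis
      using that z[of "K - i"] z[of "i + 1"] by (simp only:) simp
  qed
  have Z0: "zeta_nat (2 * K + 2) = - ?c * b (K + 1)"
    using zeta_nat_even[of "K + 1"] by (simp add: b_def)
  have b0: "b 0 = 1" by (simp add: b_def bernoulli_0)
  have "of_real pi * (\<i> * \<tau> * (\<psi> \<tau> - \<tau> ^ (2 * K) * \<psi> (- 1 / \<tau>)))
     = - 2 * \<tau>\<^sup>2 * (?X1 - \<tau> ^ (2 * K) * ?X2) - zeta_nat (2 * K + 2) * (1 + \<tau> ^ (2 * (K + 1)))"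
    using \<tau>0 by (simp add: field_simps power2_eq_square)
  also have "- 2 * \<tau>\<^sup>2 * (?X1 - \<tau> ^ (2 * K) * ?X2) = (\<Sum>i<K. 2 * (\<tau> ^ (2 * (i + 1)) * ?Z i))"
    unfolding main by (simp add: sum_distrib_left power2_eq_square mult_ac)
  also have "\<dots> = ?c * (\<Sum>i<K. b (i + 1) * b (K + 1 - (i + 1)) * \<tau> ^ (2 * (i + 1)))"
    unfolding sum_distrib_left by (rule sum.cong) (use Z in auto)
  also have "\<dots> - zeta_nat (2 * K + 2) * (1 + \<tau> ^ (2 * (K + 1))) =
      ?c * ((\<Sum>i<K. b (i + 1) * b (K + 1 - (i + 1)) * \<tau> ^ (2 * (i + 1))) + b (K + 1) * (1 + \<tau> ^ (2 * (K + 1))))"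
  proof -
    have "c * S - - c * B * (1 + t) = c * (S + B * (1 + t))" for c S B t :: complex
      by (simp add: algebra_simps)
    then show ?thesis unfolding Z0 .
  qed
  \<comment> \<open>Since \<open>b 0\<close> is 1, the two copies of \<open>b (K + 1)\<close> are
    the missing end terms of the convolution.\<close>
  also have "(\<Sum>i<K. b (i + 1) * b (K + 1 - (i + 1)) * \<tau> ^ (2 * (i + 1))) + b (K + 1) * (1 + \<tau> ^ (2 * (K + 1)))
     = (\<Sum>j\<le>K + 1. b j * b (K + 1 - j) * \<tau> ^ (2 * j))"
  proof -
    have "(\<Sum>j\<le>K + 1. f j) = f 0 + ((\<Sum>i<K. f (i + 1)) + f (K + 1))" for f :: "nat \<Rightarrow> complex"
      by (simp only: Suc_eq_plus1[symmetric] sum.atMost_Suc_shift) (simp flip: lessThan_Suc_atMost)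
    from this[of "\<lambda>j. b j * b (K + 1 - j) * \<tau> ^ (2 * j)"] show ?thesis by (simp add: b0 algebra_simps)
  qed
  finally have "of_real pi * (\<i> * \<tau> * (\<psi> \<tau> - \<tau> ^ (2 * K) * \<psi> (- 1 / \<tau>)))
     = of_real pi * ((-1) ^ (K + 1) * (2 * of_real pi) ^ (2 * K + 1) * (\<Sum>j\<le>K + 1. b j * b (K + 1 - j) * \<tau> ^ (2 * j)))"
    by simp
  then show ?thesis by (subst (asm) mult_left_cancel) auto
qed

section \<open>The special angle\<close>

lemma angle_values:
  fixes \<theta> :: real
  assumes "0 < \<theta>" "\<theta> < pi / 2" "cot \<theta> = sqrt 15"
  shows "sin \<theta> = 1 / 4" "cos \<theta> = sqrt 15 / 4"
proof -
  have s: "sin \<theta> > 0" using assms by (intro sin_gt_zero) auto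
  have c: "cos \<theta> = sqrt 15 * sin \<theta>"
    using assms(3) s by (simp add: cot_def field_simps)
  have "16 * (sin \<theta>)\<^sup>2 = 1"
    using sin_cos_squared_add[of \<theta>] unfolding c by (simp add: power_mult_distrib)
  then have "(4 * sin \<theta>)\<^sup>2 = 1\<^sup>2" by (simp add: power_mult_distrib)
  then have "4 * sin \<theta> = 1" using s by (subst (asm) power2_eq_iff_nonneg) auto
  then show "sin \<theta> = 1 / 4" by simp
  then show "cos \<theta> = sqrt 15 / 4" using c by simp
qed

text \<open>
  Since \<open>2 cos (2 \<theta>) = 7/4\<close>, we have \<open>4 ^ (n - 1) sin (2 n \<theta>) = u n sin (2 \<theta>)\<close> for the integer
  sequence \<open>u 0 = 0\<close>, \<open>u 1 = 1\<close>, \<open>u (n + 2) = 7 u (n + 1) - 16 u n\<close>, whose terms with \<open>n \<ge> 1\<close>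
  are all odd.
\<close>

lemma sin_multiple_nonzero:
  fixes \<theta> :: real
  assumes "sin \<theta> = 1 / 4" "cos \<theta> = sqrt 15 / 4" "k \<ge> 1"
  shows "sin (2 * real k * \<theta>) \<noteq> 0"
proof -
  define x where "x = 2 * \<theta>"
  have cx: "cos x = 7 / 8" unfolding x_def cos_double assms(1,2)
    by (simp add: power_divide)
  have sx: "sin x \<noteq> 0" unfolding x_def sin_double assms(1,2) by simp
  have rec: "sin (real (Suc (Suc n)) * x) = 7 / 4 * sin (real (Suc n) * x) - sin (real n * x)" for n
  proof -
    have "sin (real (Suc n) * x + x) + sin (real (Suc n) * x - x) = 2 * cos x * sin (real (Suc n) * x)"
      by (simp add: sin_add sin_diff)
    moreover have "real (Suc n) * x + x = real (Suc (Suc n)) * x" "real (Suc n) * x - x = real n * x"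
      by (simp_all add: algebra_simps)
    ultimately show ?thesis by (simp add: cx)
  qed
  \<comment> \<open>Both sines are scaled by the same power of 4, so the witnesses are the sequence
    at n + 1 and four times the sequence at n; the step sends (u, v) to (7u - 4v, 4u), which keeps
    the first entry odd.\<close>
  have "\<exists>u v :: int. odd u \<and> 4 ^ n * sin (real (Suc n) * x) = of_int u * sin x \<and>
           4 ^ n * sin (real n * x) = of_int v * sin x" for n
  proof (induction n)
    case 0
    show ?case by (intro exI[of _ 1] exI[of _ 0]) simp
  next
    case (Suc n)
    then obtain u v :: int where uv: "odd u" "4 ^ n * sin (real (Suc n) * x) = of_int u * sin x"
        "4 ^ n * sin (real n * x) = of_int v * sin x" by blast
    have "4 ^ Suc n * sin (real (Suc (Suc n)) * x)
        = 7 * (4 ^ n * sin (real (Suc n) * x)) - 4 * (4 ^ n * sin (real n * x))"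
      unfolding rec by (simp add: algebra_simps)
    also have "\<dots> = of_int (7 * u - 4 * v) * sin x"
      unfolding uv by (simp add: algebra_simps)
    finally have "4 ^ Suc n * sin (real (Suc (Suc n)) * x) = of_int (7 * u - 4 * v) * sin x" .
    moreover have "4 ^ Suc n * sin (real (Suc n) * x) = of_int (4 * u) * sin x"
      using uv(2) by simp
    moreover have "odd (7 * u - 4 * v)" using uv(1) by simp
    ultimately show ?case by blast
  qed
  then obtain u :: int where "odd u" "4 ^ (k - 1) * sin (real (Suc (k - 1)) * x) = of_int u * sin x"
    by blast
  then have "sin (real k * x) \<noteq> 0" using assms(3) sx by (auto simp del: of_nat_Suc)
  then show ?thesis by (simp add: x_def mult_ac)
qed

text \<open>The reflection of j to 2k + 1 - j has no fixed point. It preserves the product of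
  Bernoulli numbers and conjugates the unit factors in the sum to which it is applied.\<close>

lemma sum_atMost_odd_pairs:
  fixes f :: "nat \<Rightarrow> 'a :: comm_monoid_add"
  shows "(\<Sum>j\<le>2 * k + 1. f j) = (\<Sum>j=0..k. f j + f (2 * k + 1 - j))"
proof -
  have "{..2 * k + 1} = {0..k} \<union> {k + 1..2 * k + 1}" by auto
  then have "(\<Sum>j\<le>2 * k + 1. f j) = (\<Sum>j=0..k. f j) + (\<Sum>j=k+1..2 * k + 1. f j)"
    by (simp add: sum.union_disjoint)
  also have "(\<Sum>j=k+1..2 * k + 1. f j) = (\<Sum>j=0..k. f (2 * k + 1 - j))"
    by (rule sum.reindex_bij_witness[of _ "\<lambda>j. 2 * k + 1 - j" "\<lambda>j. 2 * k + 1 - j"]) auto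
  finally show ?thesis by (simp add: sum.distrib)
qed

theorem theorem4p5:
  fixes \<theta> :: real and k :: nat
  assumes "0 < \<theta>" and "\<theta> < pi / 2" and "cot \<theta> = sqrt 15"
    and "k \<ge> 1"
  shows "riemann_zeta (of_nat (4 * k + 1)) =
      of_real ((2 * pi) ^ (4 * k + 1) *
        (\<Sum>j = 0..k. (-1) ^ j * c_coeff \<theta> j k * bernoulli (2 * j) * bernoulli (4 * k + 2 - 2 * j)
           / (fact (2 * j) * fact (4 * k + 2 - 2 * j))))
    + of_real (cot (2 * real k * \<theta>)) *
        lambert_S (exp (- (sqrt 15 * pi))) (- 4 * of_nat k - 1)
    + (2 powi (- 4 * int k) + 2) *
        lambert (of_real (exp (- (sqrt 15 * pi)))) (- 4 * of_nat k - 1)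
    - (2 powi (- 8 * int k) + 3 * 2 powi (- 4 * int k) + 4) *
        lambert (of_real (exp (- (2 * sqrt 15 * pi)))) (- 4 * of_nat k - 1)
    + (2 powi (- 8 * int k) + 2 powi (- 4 * int k + 1)) *
        lambert (of_real (exp (- (4 * sqrt 15 * pi)))) (- 4 * of_nat k - 1)"
proof -
  note sin_cos = angle_values[OF assms(1-3)]
  define \<tau> where "\<tau> = \<i> * cis (- \<theta>)"
  define p where "p = 4 * k + 1"
  \<comment> \<open>The positive square root of the nome in the claim; its powers 2, 4 and 8 are the
    nomes of the three Lambert series there.\<close>
  define q1 where "q1 = exp (- (sqrt 15 * pi) / 2)"
  define A where "A = lambert (\<i> * of_real q1) (- of_nat p)"
  define B where "B = lambert (- \<i> * of_real q1) (- of_nat p)"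
  define Z where "Z = zeta_nat p"
  define b where "b j = bernoulli (2 * j) / fact (2 * j)" for j
  define s where "s = sin (2 * real k * \<theta>)"
  have s0: "s \<noteq> 0" unfolding s_def by (rule sin_multiple_nonzero) (use sin_cos assms in auto)
  have Im: "Im \<tau> > 0" by (simp add: \<tau>_def sin_cos)
  have inv: "- 1 / \<tau> = \<i> * cis \<theta>"
    by (simp add: \<tau>_def divide_simps cis_mult mult_ac)
  have q: "exp (2 * of_real pi * \<i> * \<tau>) = \<i> * of_real q1"
    "exp (2 * of_real pi * \<i> * (\<i> * cis \<theta>)) = - \<i> * of_real q1"
  proof -
    have half: "cis (pi / 2) = \<i>" "cis (- (pi / 2)) = - \<i>" by (simp_all add: complex_eq_iff)
    \<comment> \<open>Here Re \<tau> = sin \<theta> = 1/4 makes the imaginary part \<pi>/2, and Im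
      \<tau> = cos \<theta> gives the modulus \<open>q1\<close>; passing to -1/\<tau> only flips the
      sign of the real part of \<tau>.\<close>
    have 1: "2 * of_real pi * \<i> * \<tau> = Complex (- (sqrt 15 * pi) / 2) (pi / 2)"
      "2 * of_real pi * \<i> * (\<i> * cis \<theta>) = Complex (- (sqrt 15 * pi) / 2) (- (pi / 2))"
      by (simp_all add: \<tau>_def complex_eq_iff sin_cos)
    show "exp (2 * of_real pi * \<i> * \<tau>) = \<i> * of_real q1"
      "exp (2 * of_real pi * \<i> * (\<i> * cis \<theta>)) = - \<i> * of_real q1"
      unfolding 1 q1_def by (simp_all add: exp_eq_polar half mult.commute)
  qed
  have "\<i> * \<tau> * ((Z + 2 * A) - \<tau> ^ (2 * (2 * k)) * (Z + 2 * B)) =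
      (-1) ^ (2 * k + 1) * (2 * of_real pi) ^ (2 * (2 * k) + 1) *
        (\<Sum>j\<le>2 * k + 1. of_real (b j) * of_real (b (2 * k + 1 - j)) * \<tau> ^ (2 * j))"
    using lambert_reciprocity[OF Im, of "2 * k"] assms(4)
    unfolding inv q by (simp add: Z_def A_def B_def p_def b_def)
  then have rec: "\<i> * \<tau> * ((Z + 2 * A) - \<tau> ^ (4 * k) * (Z + 2 * B)) =
      - ((2 * of_real pi) ^ p * (\<Sum>j\<le>2 * k + 1. of_real (b j) * of_real (b (2 * k + 1 - j)) * \<tau> ^ (2 * j)))"
    by (simp add: p_def)
  let ?w = "cis (2 * real k * \<theta>)"
  have \<tau>pow: "\<tau> ^ (2 * j) = (-1) ^ j * cis (- (2 * real j * \<theta>))" for j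
  proof -
    have "\<i> ^ (2 * j) = (-1) ^ j" by (simp add: power_mult)
    moreover have "real (2 * j) * - \<theta> = - (2 * real j * \<theta>)" by simp
    then have "cis (- \<theta>) ^ (2 * j) = cis (- (2 * real j * \<theta>))" by (simp only: Complex.DeMoivre)
    ultimately show ?thesis by (simp only: \<tau>_def power_mult_distrib)
  qed
  \<comment> \<open>Multiplication by this unit number symmetrizes the reciprocity formula: the
    factors of the two Lambert expressions become conjugate, and \<tau>^(2j) becomes a sign times a
    unit number whose angle is odd under j to 2k + 1 - j.\<close>
  have "?w * (Z + 2 * A) - cis (- (2 * real k * \<theta>)) * (Z + 2 * B)
      = - cis ((2 * real k + 1) * \<theta>) * (\<i> * \<tau> * ((Z + 2 * A) - \<tau> ^ (4 * k) * (Z + 2 * B)))"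
  proof -
    have "\<tau> ^ (4 * k) = cis (- (4 * real k * \<theta>))" using \<tau>pow[of "2 * k"] by simp
    moreover have "\<i> * \<tau> = - cis (- \<theta>)" by (simp add: \<tau>_def)
    moreover have "- cis ((2 * real k + 1) * \<theta>) * (- cis (- \<theta>)) = ?w" by (simp add: cis_mult algebra_simps)
    moreover have "?w * cis (- (4 * real k * \<theta>)) = cis (- (2 * real k * \<theta>))" by (simp add: cis_mult algebra_simps)
    ultimately show ?thesis by (simp only: mult.assoc[symmetric] right_diff_distrib)
  qed
  also have "\<dots> = (2 * of_real pi) ^ p * (\<Sum>j\<le>2 * k + 1. of_real ((-1) ^ j * (b j * b (2 * k + 1 - j))) * cis ((2 * real k + 1 - 2 * real j) * \<theta>))"
  proof -
    have h: "cis ((2 * real k + 1) * \<theta>) * cis (- (2 * real j * \<theta>)) = cis ((2 * real k + 1 - 2 * real j) * \<theta>)" for j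
      by (simp add: cis_mult algebra_simps)
    have "cis ((2 * real k + 1) * \<theta>) * (of_real (b j) * of_real (b (2 * k + 1 - j)) * \<tau> ^ (2 * j))
       = of_real ((-1) ^ j * (b j * b (2 * k + 1 - j))) * cis ((2 * real k + 1 - 2 * real j) * \<theta>)" for j
      unfolding \<tau>pow h[symmetric] by (simp del: cis_mult)
    moreover have "- w * - (P * (\<Sum>j\<le>n. f j)) = P * (\<Sum>j\<le>n. w * f j)" for w P :: complex and f and n :: nat
      by (simp add: mult_ac flip: sum_distrib_left)
    ultimately show ?thesis unfolding rec by (simp only:)
  qed
  also have "(\<Sum>j\<le>2 * k + 1. of_real ((-1) ^ j * (b j * b (2 * k + 1 - j))) * cis ((2 * real k + 1 - 2 * real j) * \<theta>))
      = (\<Sum>j=0..k. 2 * \<i> * of_real ((-1) ^ j * (b j * b (2 * k + 1 - j)) * sin ((2 * real k + 1 - 2 * real j) * \<theta>)))"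
    unfolding sum_atMost_odd_pairs
  proof (rule sum.cong)
    fix j assume j: "j \<in> {0..k}"
    define x where "x = (2 * real k + 1 - 2 * real j) * \<theta>"
    \<comment> \<open>As 2k + 1 is odd, the reflected term has the opposite sign, so each conjugate
      pair leaves only a sine.\<close>
    have sg: "(-1) ^ (2 * k + 1 - j) = - ((-1) ^ j :: real)"
      using j by (cases "even j") (auto simp: minus_one_power_iff)
    have arg: "(2 * real k + 1 - 2 * real (2 * k + 1 - j)) * \<theta> = - x"
      using j by (simp add: x_def of_nat_diff algebra_simps)
    have jj: "2 * k + 1 - (2 * k + 1 - j) = j" using j by simp
    have "cis x - cis (- x) = 2 * \<i> * of_real (sin x)" by (simp add: complex_eq_iff)
    then have "t * cis x + - t * cis (- x) = 2 * \<i> * (t * of_real (sin x))" for t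
      by (simp add: algebra_simps)
    from this[of "of_real ((-1) ^ j * (b j * b (2 * k + 1 - j)))"]
    show "of_real ((-1) ^ j * (b j * b (2 * k + 1 - j))) * cis ((2 * real k + 1 - 2 * real j) * \<theta>) +
       of_real ((-1) ^ (2 * k + 1 - j) * (b (2 * k + 1 - j) * b (2 * k + 1 - (2 * k + 1 - j)))) * cis ((2 * real k + 1 - 2 * real (2 * k + 1 - j)) * \<theta>)
      = 2 * \<i> * of_real ((-1) ^ j * (b j * b (2 * k + 1 - j)) * sin ((2 * real k + 1 - 2 * real j) * \<theta>))"
      unfolding arg jj sg x_def[symmetric] by (simp add: mult_ac)
  qed simp
  also have "(\<Sum>j=0..k. 2 * \<i> * of_real ((-1) ^ j * (b j * b (2 * k + 1 - j)) * sin ((2 * real k + 1 - 2 * real j) * \<theta>)))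
     = 2 * \<i> * of_real s * of_real (\<Sum>j = 0..k. (-1) ^ j * c_coeff \<theta> j k * bernoulli (2 * j) * bernoulli (4 * k + 2 - 2 * j)
           / (fact (2 * j) * fact (4 * k + 2 - 2 * j)))" (is "_ = _ * of_real ?S")
    unfolding of_real_sum sum_distrib_left
  proof (rule sum.cong)
    fix j assume "j \<in> {0..k}"
    have "2 * (2 * k + 1 - j) = 4 * k + 2 - 2 * j" by simp
    then have "b (2 * k + 1 - j) = bernoulli (4 * k + 2 - 2 * j) / fact (4 * k + 2 - 2 * j)"
      unfolding b_def by simp
    then have "(-1) ^ j * (b j * b (2 * k + 1 - j)) * sin ((2 * real k + 1 - 2 * real j) * \<theta>)
       = s * ((-1) ^ j * c_coeff \<theta> j k * bernoulli (2 * j) * bernoulli (4 * k + 2 - 2 * j)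
           / (fact (2 * j) * fact (4 * k + 2 - 2 * j)))"
      using s0 unfolding c_coeff_def s_def[symmetric] by (simp add: b_def)
    then show "2 * \<i> * of_real ((-1) ^ j * (b j * b (2 * k + 1 - j)) * sin ((2 * real k + 1 - 2 * real j) * \<theta>))
       = 2 * \<i> * of_real s * of_real ((-1) ^ j * c_coeff \<theta> j k * bernoulli (2 * j) * bernoulli (4 * k + 2 - 2 * j)
           / (fact (2 * j) * fact (4 * k + 2 - 2 * j)))"
      by (simp only: of_real_mult mult.assoc)
  qed simp
  finally have main: "?w * (Z + 2 * A) - cis (- (2 * real k * \<theta>)) * (Z + 2 * B)
      = 2 * \<i> * of_real s * of_real ((2 * pi) ^ p * ?S)"
    by (simp add: mult_ac)
  \<comment> \<open>Splitting the unit factors into cosine and sine, the sine part multiplies Z + A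
    + B and the cosine part multiplies A - B; taking out 2\<i>s produces the cotangent.\<close>
  have "?w * (Z + 2 * A) - cis (- (2 * real k * \<theta>)) * (Z + 2 * B)
     = 2 * \<i> * of_real s * (Z + (A + B) - of_real (cot (2 * real k * \<theta>)) * (\<i> * (A - B)))"
  proof -
    have w: "?w = of_real (cos (2 * real k * \<theta>)) + \<i> * of_real s"
      "cis (- (2 * real k * \<theta>)) = of_real (cos (2 * real k * \<theta>)) - \<i> * of_real s"
      by (simp_all add: complex_eq_iff s_def)
    have c: "of_real s * of_real (cot (2 * real k * \<theta>)) = (of_real (cos (2 * real k * \<theta>)) :: complex)"
      using s0 by (simp add: cot_def s_def)
    show ?thesis unfolding w c[symmetric] by (simp add: algebra_simps)
  qed
  then have "2 * \<i> * of_real s * (Z + (A + B) - of_real (cot (2 * real k * \<theta>)) * (\<i> * (A - B)))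
     = 2 * \<i> * of_real s * of_real ((2 * pi) ^ p * ?S)"
    unfolding main by (rule sym)
  then have "Z + (A + B) - of_real (cot (2 * real k * \<theta>)) * (\<i> * (A - B)) = of_real ((2 * pi) ^ p * ?S)"
    by (subst (asm) mult_left_cancel) (use s0 in auto)
  then have zeta: "Z = of_real ((2 * pi) ^ p * ?S) + of_real (cot (2 * real k * \<theta>)) * (\<i> * (A - B)) - (A + B)"
    by (simp only: diff_eq_eq eq_diff_eq add.commute)
  have q1: "0 \<le> q1" "q1 < 1" by (auto simp: q1_def)
  have qpow: "q1 ^ 2 = exp (- (sqrt 15 * pi))" "q1 ^ 4 = exp (- (2 * sqrt 15 * pi))" "q1 ^ 8 = exp (- (4 * sqrt 15 * pi))"
    by (simp_all add: q1_def flip: exp_of_nat_mult)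
  have sq: "sqrt (exp (- (sqrt 15 * pi))) = q1"
    unfolding qpow(1)[symmetric] using q1(1) by simp
  have arg: "- 4 * of_nat k - 1 = (- of_nat p :: complex)" by (simp add: p_def)
  have AB: "A + B = - 2 * (1 + 1 / 2 ^ p) * lambert (of_real (q1 ^ 2)) (- of_nat p)
      + (4 + 6 * (1 / 2 ^ p) + 4 * (1 / 2 ^ p)\<^sup>2) * lambert (of_real (q1 ^ 4)) (- of_nat p)
      - 4 * (1 / 2 ^ p) * (1 + 1 / 2 ^ p) * lambert (of_real (q1 ^ 8)) (- of_nat p)"
    unfolding A_def B_def by (rule lambert_imaginary_sum[OF q1])
  have S: "lambert_S (exp (- (sqrt 15 * pi))) (- of_nat p) = \<i> * (A - B)"
    unfolding lambert_S_def sq A_def B_def ..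
  \<comment> \<open>The exponent is p = 4k + 1 and not 4k, so 2^(-4k) is 2c; this shift turns the
    coefficients of \<open>lambert_imaginary_sum\<close> into those of the claim.\<close>
  define c where "c = (1 / 2 ^ p :: complex)"
  have pw: "2 powi (- 4 * int k) = 2 * c" "2 powi (- 8 * int k) = 4 * c\<^sup>2" "2 powi (- 4 * int k + 1) = 4 * c"
  proof -
    have "- 4 * int k = - int (4 * k)" by simp
    then have "2 powi (- 4 * int k) = 1 / (2 ^ (4 * k) :: complex)"
      by (simp only: power_int_minus power_int_of_nat inverse_eq_divide)
    then show 2: "2 powi (- 4 * int k) = 2 * c" by (simp add: c_def p_def)
    show "2 powi (- 4 * int k + 1) = 4 * c"
      using power_int_add[of "2 :: complex" "- 4 * int k" 1] unfolding 2 by simp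
    have "2 powi (- 8 * int k) = (2 powi (- 4 * int k) * 2 powi (- 4 * int k) :: complex)"
      using power_int_add[of "2 :: complex" "- 4 * int k" "- 4 * int k"] by simp
    then show "2 powi (- 8 * int k) = 4 * c\<^sup>2" unfolding 2 by (simp add: power2_eq_square)
  qed
  have "riemann_zeta (of_nat (4 * k + 1)) = Z"
    unfolding Z_def p_def by (rule riemann_zeta_of_nat) (use assms(4) in auto)
  then show ?thesis
    unfolding zeta arg S AB pw c_def[symmetric] qpow
    by (simp add: p_def algebra_simps power2_eq_square)
qed

end
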